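(* Let $q>1$ and let $W$ be a standard Brownian motion in $\mathbb{R}$ with local time $\ell_t(x)$, and for $\epsilon>0$ let $\ell_{t,\epsilon}(x)=\int_0^tp_\epsilon(W_s-x)\,ds$. Then for any $\lambda>0$, $$\limsup_{\epsilon\to0}\limsup_{t\to\infty}\frac1t\log\mathbb{E}\exp\{\lambda\|\ell_t-\ell_{t,\epsilon}\|_q\}=0.$$
   Context: $\ell_t(x)=\int_0^t\delta(W_s-x)\,ds$ is the local time of $W$, i.e. the (a.s. continuous) density with respect to Lebesgue measure of $A\mapsto\int_0^t\mathbf 1_A(W_s)\,ds$. $p_\epsilon(x)=(2\pi\epsilon)^{-1/2}e^{-x^2/2\epsilon}$ is the Gaussian kernel, so $\ell_{t,\epsilon}=\ell_t*p_\epsilon$. $\|\cdot\|_q$ is the $L^q(\mathbb{R})$ norm. *)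

theory Defs
  imports "HOL-Probability.Probability"
begin

locale standard_brownian_motion = prob_space M
  for M :: "'a measure" and W :: "real \<Rightarrow> 'a \<Rightarrow> real" +
  assumes random_variable: "0 \<le> t \<Longrightarrow> W t \<in> borel_measurable M"
    and starts_at_0: "AE \<omega> in M. W 0 \<omega> = 0"
    and gaussian_increments:
      "\<lbrakk>0 \<le> s; s < t\<rbrakk> \<Longrightarrow>
        distributed M lborel (\<lambda>\<omega>. W t \<omega> - W s \<omega>) (normal_density 0 (sqrt (t - s)))"
    and independent_increments:
      "\<lbrakk>0 \<le> \<tau> 0; \<And>i. i < n \<Longrightarrow> \<tau> i \<le> \<tau> (Suc i)\<rbrakk> \<Longrightarrow>
        indep_vars (\<lambda>_. borel) (\<lambda>i \<omega>. W (\<tau> (Suc i)) \<omega> - W (\<tau> i) \<omega>) {..<(n::nat)}"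
    and continuous_paths: "AE \<omega> in M. continuous_on {0..} (\<lambda>t. W t \<omega>)"

text \<open>
  \<open>l\<close> is a density of the occupation measure of the path \<open>w\<close> up to time \<open>t\<close>. Nonnegativity has
  to be required separately, because \<open>ennreal\<close> truncates negative values to 0.
\<close>

definition occupation_density :: "(real \<Rightarrow> real) \<Rightarrow> real \<Rightarrow> (real \<Rightarrow> real) \<Rightarrow> bool" where
  "occupation_density w t l \<longleftrightarrow>
     (\<forall>x. 0 \<le> l x) \<and>
     (\<forall>A\<in>sets borel. (\<integral>\<^sup>+s\<in>{0..t}. indicator A (w s) \<partial>lborel) = (\<integral>\<^sup>+x\<in>A. ennreal (l x) \<partial>lborel))"

text \<open>
  The value of the local time at time \<open>t\<close>, point \<open>x\<close> and outcome \<open>\<omega>\<close> is \<open>L t x \<omega>\<close>. For each \<open>t\<close>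
  it is the continuous occupation density for almost every \<open>\<omega>\<close>, and thus it is determined up
  to a null set. The null set may depend on \<open>t\<close>, so versions that are continuous in
  \<open>(t, x)\<close> are included but not singled out.
\<close>

definition local_time ::
  "'a measure \<Rightarrow> (real \<Rightarrow> 'a \<Rightarrow> real) \<Rightarrow> (real \<Rightarrow> real \<Rightarrow> 'a \<Rightarrow> real) \<Rightarrow> bool" where
  "local_time M W L \<longleftrightarrow>
     (\<forall>t\<ge>0. AE \<omega> in M. continuous_on UNIV (\<lambda>x. L t x \<omega>) \<and>
        occupation_density (\<lambda>s. W s \<omega>) t (\<lambda>x. L t x \<omega>))"

definition gauss_kernel :: "real \<Rightarrow> real \<Rightarrow> real" where
  "gauss_kernel \<epsilon> x = (2 * pi * \<epsilon>) powr (- 1 / 2) * exp (- x\<^sup>2 / (2 * \<epsilon>))"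

lemma gauss_kernel_eq_normal_density:
  assumes "0 < \<epsilon>"
  shows "gauss_kernel \<epsilon> x = normal_density 0 (sqrt \<epsilon>) x"
proof -
  have "(2 * pi * \<epsilon>) powr (- 1 / 2) = 1 / sqrt (2 * pi * \<epsilon>)"
    using assms powr_minus_divide[of "2 * pi * \<epsilon>" "1 / 2"] powr_half_sqrt[of "2 * pi * \<epsilon>"]
    by (metis less_imp_le minus_divide_left mult_pos_pos pi_gt_zero zero_less_numeral)
  moreover have "(sqrt \<epsilon>)\<^sup>2 = \<epsilon>"
    using assms by simp
  ultimately show ?thesis
    by (simp only: gauss_kernel_def normal_density_def) simp
qed

definition smoothed_local_time ::
  "(real \<Rightarrow> 'a \<Rightarrow> real) \<Rightarrow> real \<Rightarrow> real \<Rightarrow> real \<Rightarrow> 'a \<Rightarrow> real" where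
  "smoothed_local_time W \<epsilon> t x \<omega> = (LINT s:{0..t}|lborel. gauss_kernel \<epsilon> (W s \<omega> - x))"

text \<open>
  The norm, the exponential and the logarithm take extended values: an infinite norm or an infinite
  exponential moment is represented by \<open>\<infinity>\<close>, whereas the real-valued versions would
  collapse these cases to 0 (Bochner integrals of non-integrable functions, and \<open>ln 0 = 0\<close>).
\<close>

definition Lq_norm :: "real \<Rightarrow> (real \<Rightarrow> real) \<Rightarrow> ennreal" where
  "Lq_norm q f =
     (let I = (\<integral>\<^sup>+x. ennreal (\<bar>f x\<bar> powr q) \<partial>lborel)
      in if I = \<infinity> then \<infinity> else ennreal (enn2real I powr (1 / q)))"

definition ennreal_exp :: "ennreal \<Rightarrow> ennreal" where
  "ennreal_exp x = (if x = \<infinity> then \<infinity> else ennreal (exp (enn2real x)))"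

definition ennreal_ln :: "ennreal \<Rightarrow> ereal" where
  "ennreal_ln x =
     (if x = 0 then - \<infinity> else if x = \<infinity> then \<infinity> else ereal (ln (enn2real x)))"

end

theory Submission
  imports Defs
begin

text \<open>
  Write \<open>N t\<close> for the norm of \<open>l t - l t * p \<epsilon>\<close>. The increments of \<open>W\<close> are independent and stationary and
  the norm is a translation invariant seminorm, so the exponential moment of \<open>N (n \<delta>)\<close> is at most the
  \<open>n\<close>-th power of that of \<open>N \<delta>\<close>; hence the growth rate is at most \<open>1/\<delta>\<close> times the logarithm of
  the moment at the fixed time \<open>\<delta>\<close>. As \<open>\<epsilon>\<close> tends to 0, \<open>N \<delta>\<close> tends to 0 almost surely, because \<open>l \<delta>\<close> is
  continuous with compact support, and the moment tends to 1 by uniform integrability. The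
  latter comes from Khas'minskii's lemma: for small \<open>\<delta>\<close>, the local time at a point has exponential moments
  at most 2, and the exponential of the norm is controlled by the space integral of pointwise exponentials.

  All estimates are made for Riemann sums of \<open>p \<eta> (W s - x) - p \<epsilon> (W s - x)\<close>, which are functions of a
  Gaussian random walk, and are transferred by Fatou's lemma, first refining the grid and then
  letting \<open>\<eta>\<close> tend to 0. In this way paths and local time enter only through pathwise limits, which
  avoids any appeal to joint measurability in time, space and outcome.
\<close>

section \<open>The \<open>L\<^sup>q\<close> norm and the exponential\<close>

text \<open>The accumulated drift in Khas'minskii's argument over \<open>k\<close> steps of length
  \<open>h\<close> is at most \<open>h / sqrt \<epsilon> + 2 * sqrt (real k * h)\<close>. The second
  term is small because a block is short, whatever the smoothing. The first is an artefact of the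
  grid and vanishes only if the mesh shrinks at fixed \<open>\<epsilon>\<close>. This dictates the
  order of the two limits, and it is why the moment bounds hold only for fine grids, with a
  threshold that depends on the smoothing.

  The block length \<open>\<delta>\<close> is chosen from \<open>lam\<close> alone. A block moment
  of at most \<open>1 + \<rho>\<close> therefore gives a growth rate of at most
  \<open>\<rho> / \<delta>\<close> with a fixed denominator, while \<open>\<rho>\<close> is
  arbitrary.

  The exponent doubles three times: for the second moment behind uniform integrability, for
  separating the two terms of a difference, and for passing from the norm to pointwise exponentials.
  So a moment at \<open>lam\<close> rests on Khas'minskii's bound at \<open>8 * lam\<close>. All
  other losses, from the incomplete last block and from the final passage to the limit, are factors
  independent of time, which the logarithm divided by \<open>t\<close> removes.\<close>

lemma ennreal_exp_ennreal: "0 \<le> r \<Longrightarrow> ennreal_exp (ennreal r) = ennreal (exp r)"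
  by (simp add: ennreal_exp_def)

lemma ennreal_exp_mono: "x \<le> y \<Longrightarrow> ennreal_exp x \<le> ennreal_exp y"
  by (cases x; cases y) (auto simp: ennreal_exp_def top_unique)

lemma ennreal_exp_ge_1: "1 \<le> ennreal_exp x"
  by (cases x) (auto simp: ennreal_exp_def)

lemma ennreal_exp_add: "ennreal_exp (x + y) = ennreal_exp x * ennreal_exp y"
  by (cases x; cases y)
    (auto simp: ennreal_exp_def ennreal_mult ennreal_mult_eq_top_iff exp_add simp flip: ennreal_plus)

text \<open>The sum is at most twice the larger term. A sum of two exponentials at doubled exponent
  can be integrated term by term, which takes the place of the Cauchy-Schwarz inequality.\<close>

lemma ennreal_exp_add_le: "ennreal_exp (x + y) \<le> ennreal_exp (2 * x) + ennreal_exp (2 * y)"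
proof (cases "x \<le> y")
  case True
  then have "x + y \<le> 2 * y" by (metis add_right_mono mult_2)
  from ennreal_exp_mono[OF this] show ?thesis by (meson add_increasing zero_le)
next
  case False
  then have "x + y \<le> 2 * x" by (metis add_left_mono mult_2 linear)
  from ennreal_exp_mono[OF this] show ?thesis by (meson add_increasing2 zero_le)
qed

lemma borel_measurable_ennreal_exp [measurable]: "ennreal_exp \<in> borel_measurable borel"
  unfolding ennreal_exp_def by measurable

section \<open>\<open>Lq_norm\<close> as an extended seminorm\<close>

lemma Lq_norm_le_iff:
  assumes "0 < q" "0 \<le> c"
  shows "Lq_norm q f \<le> ennreal c \<longleftrightarrow> (\<integral>\<^sup>+x. ennreal (\<bar>f x\<bar> powr q) \<partial>lborel) \<le> ennreal (c powr q)"
proof (cases "\<integral>\<^sup>+x. ennreal (\<bar>f x\<bar> powr q) \<partial>lborel")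
  case (real r)
  have "r powr (1 / q) \<le> c \<longleftrightarrow> r \<le> c powr q"
  proof
    assume "r powr (1 / q) \<le> c"
    then have "(r powr (1 / q)) powr q \<le> c powr q"
      using assms by (intro powr_mono2) auto
    then show "r \<le> c powr q" using assms real by (simp add: powr_powr)
  next
    assume "r \<le> c powr q"
    then have "r powr (1 / q) \<le> (c powr q) powr (1 / q)"
      using assms real by (intro powr_mono2) auto
    then show "r powr (1 / q) \<le> c" using assms by (simp add: powr_powr)
  qed
  then show ?thesis using real assms by (simp add: Lq_norm_def Let_def)
next
  case top
  then show ?thesis by (simp add: Lq_norm_def Let_def top_unique)
qed

lemma Lq_norm_cong: "(\<And>x. \<bar>f x\<bar> = \<bar>g x\<bar>) \<Longrightarrow> Lq_norm q f = Lq_norm q g"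
  by (simp add: Lq_norm_def)

text \<open>Convexity of the power at the points \<open>u / a\<close> and \<open>v / b\<close>, with
  weights proportional to \<open>a\<close> and \<open>b\<close>. When \<open>a\<close> and
  \<open>b\<close> bound two norms, integration turns this into Minkowski's inequality.\<close>

lemma powr_add_weighted:
  fixes a b u v q :: real
  assumes "0 < a" "0 < b" "0 \<le> u" "0 \<le> v" "1 \<le> q"
  shows "(u + v) powr q \<le> (a + b) powr (q - 1) * (a * (u / a) powr q + b * (v / b) powr q)"
proof -
  define s where "s = a / (a + b)"
  have s: "0 < s" "s < 1" and s': "1 - s = b / (a + b)"
    using assms by (auto simp: s_def field_simps)
  \<comment> \<open>If one of the points is 0, the claim reduces to \<open>s powr q \<le> s\<close>
    for a weight \<open>s\<close> below 1.\<close>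
  have conv: "(s * y + (1 - s) * z) powr q \<le> s * y powr q + (1 - s) * z powr q"
    if yz: "0 \<le> y" "0 \<le> z" for y z
  proof -
    consider "y = 0" | "z = 0" | "0 < y" "0 < z" using yz by fastforce
    then show ?thesis
    proof cases
      case 1
      have "(1 - s) powr q \<le> (1 - s) powr 1"
        using s assms by (intro powr_mono') auto
      then have "(1 - s) powr q * z powr q \<le> (1 - s) * z powr q"
        using s by (intro mult_right_mono) auto
      then show ?thesis using 1 s yz by (simp add: powr_mult)
    next
      case 2
      have "s powr q \<le> s powr 1"
        using s assms by (intro powr_mono') auto
      then have "s powr q * y powr q \<le> s * y powr q"
        using s by (intro mult_right_mono) auto
      then show ?thesis using 2 s yz by (simp add: powr_mult)
    next
      case 3
      show ?thesis
        using convex_onD[OF powr_convex[OF assms(5)], of s z y] 3 s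
        by (simp add: algebra_simps)
    qed
  qed
  have "s * (u / a) + (1 - s) * (v / b) = (u + v) / (a + b)"
    unfolding s' using assms by (simp add: s_def add_divide_distrib)
  with conv[of "u / a" "v / b"] assms
  have "((u + v) / (a + b)) powr q \<le> (a * (u / a) powr q + b * (v / b) powr q) / (a + b)"
    unfolding s' by (simp add: s_def add_divide_distrib)
  then have "(a + b) powr q * ((u + v) / (a + b)) powr q
      \<le> (a + b) powr q * ((a * (u / a) powr q + b * (v / b) powr q) / (a + b))"
    by (intro mult_left_mono) auto
  then show ?thesis
    using assms by (simp add: powr_divide powr_diff field_simps)
qed

lemma Lq_norm_triangle:
  assumes [measurable]: "f \<in> borel_measurable borel" "g \<in> borel_measurable borel"
    and q: "1 \<le> q"
  shows "Lq_norm q (\<lambda>x. f x + g x) \<le> Lq_norm q f + Lq_norm q g"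
proof -
  \<comment> \<open>The functions are normalised by \<open>a\<close> and \<open>b\<close>, which
    must not vanish although the norms may. Strictly positive upper bounds are used instead, and the
    slack is removed at the end.\<close>
  have main: "Lq_norm q (\<lambda>x. f x + g x) \<le> ennreal (a + b)"
    if ab: "0 < a" "0 < b" and fa: "Lq_norm q f \<le> ennreal a" and gb: "Lq_norm q g \<le> ennreal b" for a b
  proof -
    define c where "c = (a + b) powr (q - 1)"
    have "(\<integral>\<^sup>+x. ennreal (\<bar>f x + g x\<bar> powr q) \<partial>lborel)
        \<le> (\<integral>\<^sup>+x. ennreal (c * (a * (1 / a powr q))) * ennreal (\<bar>f x\<bar> powr q)
            + ennreal (c * (b * (1 / b powr q))) * ennreal (\<bar>g x\<bar> powr q) \<partial>lborel)"
    proof (rule nn_integral_mono)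
      fix x :: real
      have "\<bar>f x + g x\<bar> powr q \<le> (\<bar>f x\<bar> + \<bar>g x\<bar>) powr q"
        using q by (intro powr_mono2) auto
      also have "\<dots> \<le> c * (a * (\<bar>f x\<bar> / a) powr q + b * (\<bar>g x\<bar> / b) powr q)"
        unfolding c_def using ab q by (intro powr_add_weighted) auto
      also have "\<dots> = c * (a * (1 / a powr q)) * \<bar>f x\<bar> powr q + c * (b * (1 / b powr q)) * \<bar>g x\<bar> powr q"
        using ab by (simp add: powr_divide algebra_simps)
      finally show "ennreal (\<bar>f x + g x\<bar> powr q)
        \<le> ennreal (c * (a * (1 / a powr q))) * ennreal (\<bar>f x\<bar> powr q)
            + ennreal (c * (b * (1 / b powr q))) * ennreal (\<bar>g x\<bar> powr q)"
        using ab by (simp add: c_def ennreal_mult[symmetric] ennreal_plus[symmetric] del: ennreal_plus)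
    qed
    also have "\<dots> = ennreal (c * (a * (1 / a powr q))) * (\<integral>\<^sup>+x. ennreal (\<bar>f x\<bar> powr q) \<partial>lborel)
            + ennreal (c * (b * (1 / b powr q))) * (\<integral>\<^sup>+x. ennreal (\<bar>g x\<bar> powr q) \<partial>lborel)"
      by (simp add: nn_integral_add nn_integral_cmult)
    also have "\<dots> \<le> ennreal (c * (a * (1 / a powr q))) * ennreal (a powr q)
            + ennreal (c * (b * (1 / b powr q))) * ennreal (b powr q)"
      using fa gb ab q by (intro add_mono mult_left_mono) (auto simp: Lq_norm_le_iff)
    also have "\<dots> = ennreal (c * (a + b))"
      using ab by (simp add: c_def ennreal_mult[symmetric] ennreal_plus[symmetric] distrib_left del: ennreal_plus)
    also have "c * (a + b) = (a + b) powr q"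
      using ab by (simp add: c_def powr_diff)
    finally show ?thesis
      using ab q by (subst Lq_norm_le_iff) auto
  qed
  show ?thesis
  proof (rule ennreal_le_epsilon)
    fix e :: real assume fin: "Lq_norm q f + Lq_norm q g < top" and e: "0 < e"
    obtain a where a: "Lq_norm q f = ennreal a" "0 \<le> a" using fin by (cases "Lq_norm q f") auto
    obtain b where b: "Lq_norm q g = ennreal b" "0 \<le> b" using fin by (cases "Lq_norm q g") auto
    have "Lq_norm q (\<lambda>x. f x + g x) \<le> ennreal ((a + e / 2) + (b + e / 2))"
      using a b e by (intro main) (auto simp: ennreal_leI)
    also have "\<dots> = Lq_norm q f + Lq_norm q g + ennreal e"
      using a b e by (simp add: ennreal_plus[symmetric] add_ac del: ennreal_plus)
    finally show "Lq_norm q (\<lambda>x. f x + g x) \<le> Lq_norm q f + Lq_norm q g + ennreal e" .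
  qed
qed

lemma Lq_norm_minus_commute: "Lq_norm q (\<lambda>x. f x - g x) = Lq_norm q (\<lambda>x. g x - f x)"
  by (intro Lq_norm_cong) (simp add: abs_minus_commute)

lemma Lq_norm_diff_le:
  assumes "f \<in> borel_measurable borel" "g \<in> borel_measurable borel" "1 \<le> q"
  shows "Lq_norm q (\<lambda>x. f x - g x) \<le> Lq_norm q f + Lq_norm q g"
  using Lq_norm_triangle[of f "\<lambda>x. - g x" q] assms Lq_norm_cong[of "\<lambda>x. - g x" g q] by simp

lemma Lq_norm_diff_triangle:
  assumes "f \<in> borel_measurable borel" "g \<in> borel_measurable borel" "k \<in> borel_measurable borel" "1 \<le> q"
  shows "Lq_norm q (\<lambda>x. f x - k x) \<le> Lq_norm q (\<lambda>x. f x - g x) + Lq_norm q (\<lambda>x. g x - k x)"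
  using Lq_norm_triangle[of "\<lambda>x. f x - g x" "\<lambda>x. g x - k x" q] assms by simp

lemma Lq_norm_translate:
  assumes [measurable]: "f \<in> borel_measurable borel"
  shows "Lq_norm q (\<lambda>x. f (x - c)) = Lq_norm q f"
proof -
  have "(\<integral>\<^sup>+x. ennreal (\<bar>f x\<bar> powr q) \<partial>lborel) = (\<integral>\<^sup>+x. ennreal (\<bar>f (x - c)\<bar> powr q) \<partial>lborel)"
    by (subst nn_integral_real_affine[where c = 1 and t = "- c"]) auto
  then show ?thesis by (simp add: Lq_norm_def)
qed

lemma borel_measurable_Lq_norm [measurable (raw)]:
  assumes [measurable]: "(\<lambda>(\<omega>, x). f \<omega> x) \<in> borel_measurable (M \<Otimes>\<^sub>M borel)"
  shows "(\<lambda>\<omega>. Lq_norm q (f \<omega>)) \<in> borel_measurable M"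
  unfolding Lq_norm_def Let_def by measurable

lemma Lq_norm_tendsto_0:
  assumes I: "((\<lambda>n. \<integral>\<^sup>+x. ennreal (\<bar>f n x\<bar> powr q) \<partial>lborel) \<longlongrightarrow> 0) F" and q: "0 < q"
  shows "((\<lambda>n. Lq_norm q (f n)) \<longlongrightarrow> 0) F"
proof (rule order_tendstoI)
  fix y :: ennreal assume "0 < y"
  then obtain z where z: "0 < z" "z < y" using dense by blast
  then obtain c where c: "0 < c" "ennreal c < y"
    by (cases z) auto
  have "eventually (\<lambda>n. (\<integral>\<^sup>+x. ennreal (\<bar>f n x\<bar> powr q) \<partial>lborel) < ennreal (c powr q)) F"
    using c by (intro order_tendstoD(2)[OF I]) auto
  then show "eventually (\<lambda>n. Lq_norm q (f n) < y) F"
  proof eventually_elim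
    case (elim n)
    then have "Lq_norm q (f n) \<le> ennreal c" using c q by (simp add: Lq_norm_le_iff)
    then show ?case using c by simp
  qed
qed auto

text \<open>
  The integral of \<open>f\<^sup>q\<close> is split at the level \<open>f = M\<close>, where \<open>M\<close> is the norm itself: the lower part is at
  most \<open>M powr (q - 1)\<close>, so \<open>M > 2\<close> forces the upper part, and with it an exponential
  integral of \<open>f\<close>, to be large.
\<close>

lemma exp_Lq_norm_le:
  assumes [measurable]: "f \<in> borel_measurable borel"
    and f0: "\<And>x. 0 \<le> f x" and fB: "\<And>x. f x \<le> B"
    and mass: "(\<integral>\<^sup>+x. ennreal (f x) \<partial>lborel) \<le> 1"
    and q: "1 < q" and \<Lambda>: "0 < \<Lambda>"
  shows "ennreal_exp (ennreal \<Lambda> * Lq_norm q f)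
    \<le> ennreal (exp (\<Lambda> * max 2 ((q - 1) / \<Lambda>)))
      + ennreal (1 / \<Lambda>) * (\<integral>\<^sup>+x. ennreal (exp (2 * \<Lambda> * f x) - 1) \<partial>lborel)" (is "_ \<le> ?C + ?Z")
proof -
  define I where "I = (\<integral>\<^sup>+x. ennreal (\<bar>f x\<bar> powr q) \<partial>lborel)"
  define Y where "Y = (\<integral>\<^sup>+x. ennreal (f x * exp (\<Lambda> * f x)) \<partial>lborel)"
  have split: "f x powr q = f x powr (q - 1) * f x" for x
    using f0[of x] by (cases "f x = 0") (simp_all add: powr_diff)
  have Bn: "0 \<le> B" using f0[of 0] fB[of 0] by linarith
  \<comment> \<open>The bound \<open>B\<close> ensures only that the norm is finite; it does not
    enter the final estimate.\<close>
  have "I \<le> (\<integral>\<^sup>+x. ennreal (B powr (q - 1)) * ennreal (f x) \<partial>lborel)"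
    unfolding I_def using f0 fB q
    by (intro nn_integral_mono)
      (auto simp: split ennreal_mult[symmetric] intro!: ennreal_leI mult_right_mono powr_mono2)
  also have "\<dots> \<le> ennreal (B powr (q - 1)) * 1"
    using mult_left_mono[OF mass] by (simp add: nn_integral_cmult)
  finally have "I < top" by (simp add: order_le_less_trans)
  then obtain r where r: "I = ennreal r" "0 \<le> r" by (cases I) auto
  define m where "m = r powr (1 / q)"
  have m: "Lq_norm q f = ennreal m" "0 \<le> m" "m powr q = r"
    using r q by (auto simp: m_def Lq_norm_def I_def[symmetric] powr_powr)
  have exp_m: "ennreal_exp (ennreal \<Lambda> * Lq_norm q f) = ennreal (exp (\<Lambda> * m))"
    using m \<Lambda> by (simp add: ennreal_exp_ennreal ennreal_mult[symmetric])
  show ?thesis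
  proof (cases "m \<le> max 2 ((q - 1) / \<Lambda>)")
    case True
    then have "exp (\<Lambda> * m) \<le> exp (\<Lambda> * max 2 ((q - 1) / \<Lambda>))"
      using \<Lambda> by simp
    then have "ennreal (exp (\<Lambda> * m)) \<le> ?C" by (rule ennreal_leI)
    then show ?thesis unfolding exp_m by (meson add_increasing2 zero_le)
  next
    case False
    \<comment> \<open>The two entries of the maximum have separate tasks: \<open>2 < m\<close> lets
      the lower part be absorbed, and \<open>q - 1 \<le> \<Lambda> * m\<close> makes
      \<open>u powr (q - 1) * exp (- \<Lambda> * u)\<close> nonincreasing for \<open>u\<close>
      beyond \<open>m\<close>.\<close>
    then have m2: "2 < m" and mq: "q - 1 \<le> \<Lambda> * m"
      using \<Lambda> by (simp_all add: not_le pos_divide_less_eq mult.commute)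
    define c where "c = m powr (q - 1)"
    have c: "0 < c" using m2 by (simp add: c_def)
    have pt: "f x powr q \<le> c * f x + c * exp (- \<Lambda> * m) * (f x * exp (\<Lambda> * f x))" for x
    proof (cases "f x \<le> m")
      case True
      then have "f x powr (q - 1) * f x \<le> c * f x"
        unfolding c_def using f0 q by (intro mult_right_mono powr_mono2) auto
      moreover have "0 \<le> c * exp (- \<Lambda> * m) * (f x * exp (\<Lambda> * f x))"
        using c f0 by simp
      ultimately show ?thesis unfolding split by linarith
    next
      case False
      have "(q - 1) * (ln (f x) - ln m) \<le> (q - 1) * ((f x - m) / m)"
        using False m2 q ln_diff_le[of "f x" m] by (intro mult_left_mono) auto
      also have "\<dots> \<le> (\<Lambda> * m) * ((f x - m) / m)"
        using False m2 mq by (intro mult_right_mono) auto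
      also have "\<dots> = \<Lambda> * f x - \<Lambda> * m" using m2 by (simp add: field_simps)
      finally have "(q - 1) * ln (f x) \<le> (q - 1) * ln m + (\<Lambda> * f x - \<Lambda> * m)"
        by (simp add: algebra_simps)
      then have "f x powr (q - 1) \<le> c * exp (\<Lambda> * f x - \<Lambda> * m)"
        using False m2 by (simp add: powr_def c_def exp_add[symmetric])
      then have "f x powr (q - 1) * f x \<le> c * exp (\<Lambda> * f x - \<Lambda> * m) * f x"
        using f0 by (intro mult_right_mono)
      moreover have "0 \<le> c * f x" using c f0 by simp
      moreover have "c * exp (\<Lambda> * f x - \<Lambda> * m) * f x = c * exp (- \<Lambda> * m) * (f x * exp (\<Lambda> * f x))"
        by (simp add: exp_diff exp_minus field_simps)
      ultimately show ?thesis unfolding split by linarith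
    qed
    have "I \<le> (\<integral>\<^sup>+x. ennreal c * ennreal (f x)
        + ennreal (c * exp (- \<Lambda> * m)) * ennreal (f x * exp (\<Lambda> * f x)) \<partial>lborel)"
      unfolding I_def using f0 pt c
      by (intro nn_integral_mono)
        (simp add: ennreal_mult[symmetric] ennreal_plus[symmetric] del: ennreal_plus)
    also have "\<dots> = ennreal c * (\<integral>\<^sup>+x. ennreal (f x) \<partial>lborel) + ennreal (c * exp (- \<Lambda> * m)) * Y"
      unfolding Y_def by (simp add: nn_integral_add nn_integral_cmult)
    also have "\<dots> \<le> ennreal c * 1 + ennreal (c * exp (- \<Lambda> * m)) * Y"
      using mass by (intro add_mono mult_left_mono) auto
    finally have IY: "ennreal (m powr q) \<le> ennreal c + ennreal (c * exp (- \<Lambda> * m)) * Y"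
      using r m by simp
    have "ennreal (exp (\<Lambda> * m)) \<le> Y"
    proof (cases Y)
      case (real y)
      have "m powr q \<le> c + c * exp (- \<Lambda> * m) * y"
        using IY real c by (simp add: ennreal_mult[symmetric] ennreal_plus[symmetric] del: ennreal_plus)
      also have "m powr q = c * m" using m2 by (simp add: c_def powr_diff)
      finally have "c * m \<le> c * (1 + exp (- \<Lambda> * m) * y)" by (simp add: algebra_simps)
      then have "m \<le> 1 + exp (- \<Lambda> * m) * y" using c by simp
      then have "1 \<le> exp (- \<Lambda> * m) * y" using m2 by linarith
      then have "exp (\<Lambda> * m) \<le> y" by (simp add: exp_minus field_simps)
      then show ?thesis using real by (simp add: ennreal_leI)
    qed simp
    \<comment> \<open>The subtracted 1 makes the integrand vanish where \<open>f\<close> does, so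
      its integral over the whole line can be finite.\<close>
    also have "Y \<le> (\<integral>\<^sup>+x. ennreal (1 / \<Lambda>) * ennreal (exp (2 * \<Lambda> * f x) - 1) \<partial>lborel)"
      unfolding Y_def
    proof (rule nn_integral_mono)
      fix x :: real
      define u where "u = \<Lambda> * f x"
      have u: "0 \<le> u" using \<Lambda> f0 by (simp add: u_def)
      have "u \<le> exp u - 1" using exp_ge_add_one_self[of u] by linarith
      then have "u * exp u \<le> (exp u - 1) * exp u" by (rule mult_right_mono) simp
      also have "\<dots> \<le> exp u * exp u - 1" using u by (simp add: algebra_simps)
      also have "\<dots> = exp (2 * u) - 1" by (simp only: mult_2 exp_add)
      finally have "f x * exp u \<le> 1 / \<Lambda> * (exp (2 * u) - 1)"
        using \<Lambda> by (simp add: u_def field_simps)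
      then show "ennreal (f x * exp (\<Lambda> * f x)) \<le> ennreal (1 / \<Lambda>) * ennreal (exp (2 * \<Lambda> * f x) - 1)"
        using \<Lambda> u by (simp add: u_def ennreal_mult[symmetric] mult.assoc ennreal_leI)
    qed
    also have "\<dots> = ?Z" by (subst nn_integral_cmult) auto
    finally show ?thesis unfolding exp_m by (meson add_increasing zero_le)
  qed
qed

section \<open>Riemann sums and smoothing along a path\<close>

text \<open>Scheffe's lemma gives convergence in \<open>L\<^sup>1\<close> from pointwise convergence
  and convergence of the masses. As both functions lie between 0 and \<open>B\<close>, the
  \<open>q\<close>-th power of the difference is at most \<open>B powr (q - 1)\<close> times the
  difference.\<close>

lemma Lq_norm_diff_tendsto_0_Scheffe:
  fixes f :: "nat \<Rightarrow> real \<Rightarrow> real"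
  assumes [measurable]: "\<And>n. f n \<in> borel_measurable borel" "g \<in> borel_measurable borel"
    and f0: "\<And>n x. 0 \<le> f n x" and g0: "\<And>x. 0 \<le> g x"
    and fB: "\<And>n x. f n x \<le> B" and gB: "\<And>x. g x \<le> B"
    and lim: "\<And>x. (\<lambda>n. f n x) \<longlonglongrightarrow> g x"
    and mass_f: "\<And>n. (\<integral>\<^sup>+x. ennreal (f n x) \<partial>lborel) = ennreal (c n)"
    and mass_g: "(\<integral>\<^sup>+x. ennreal (g x) \<partial>lborel) = ennreal d"
    and c: "c \<longlonglongrightarrow> d" and q: "1 < q"
  shows "(\<lambda>n. Lq_norm q (\<lambda>x. f n x - g x)) \<longlonglongrightarrow> 0"
proof (rule Lq_norm_tendsto_0)
  have L1: "(\<lambda>n. \<integral>\<^sup>+x. ennreal (norm (f n x - g x)) \<partial>lborel) \<longlonglongrightarrow> 0"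
  proof (rule Scheffe_lemma1)
    show "integrable lborel (f n)" for n
      by (rule integrableI_bounded) (use f0 in \<open>simp_all add: mass_f\<close>)
    show "integrable lborel g"
      by (rule integrableI_bounded) (use g0 in \<open>simp_all add: mass_g\<close>)
    have "(\<lambda>n. ennreal (c n)) \<longlonglongrightarrow> ennreal d" using c by (rule tendsto_ennrealI)
    then show "limsup (\<lambda>n. \<integral>\<^sup>+x. ennreal (norm (f n x)) \<partial>lborel) \<le> (\<integral>\<^sup>+x. ennreal (norm (g x)) \<partial>lborel)"
      using f0 g0 by (simp add: mass_f mass_g lim_imp_Limsup)
  qed (use lim in auto)
  have "(\<lambda>n. ennreal (B powr (q - 1)) * (\<integral>\<^sup>+x. ennreal (norm (f n x - g x)) \<partial>lborel)) \<longlonglongrightarrow> ennreal (B powr (q - 1)) * 0"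
    by (rule ennreal_tendsto_cmult[OF _ L1]) simp
  then have L1': "(\<lambda>n. ennreal (B powr (q - 1)) * (\<integral>\<^sup>+x. ennreal (norm (f n x - g x)) \<partial>lborel)) \<longlonglongrightarrow> 0"
    by simp
  show "(\<lambda>n. \<integral>\<^sup>+x. ennreal (\<bar>f n x - g x\<bar> powr q) \<partial>lborel) \<longlonglongrightarrow> 0"
  proof (rule tendsto_sandwich[OF _ _ tendsto_const L1'])
    show "\<forall>\<^sub>F n in sequentially. (\<integral>\<^sup>+x. ennreal (\<bar>f n x - g x\<bar> powr q) \<partial>lborel)
        \<le> ennreal (B powr (q - 1)) * (\<integral>\<^sup>+x. ennreal (norm (f n x - g x)) \<partial>lborel)"
    proof (intro always_eventually allI)
      fix n
      have "(\<integral>\<^sup>+x. ennreal (\<bar>f n x - g x\<bar> powr q) \<partial>lborel)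
          \<le> (\<integral>\<^sup>+x. ennreal (B powr (q - 1)) * ennreal (norm (f n x - g x)) \<partial>lborel)"
      proof (rule nn_integral_mono)
        fix x
        define u where "u = \<bar>f n x - g x\<bar>"
        have u: "0 \<le> u" "u \<le> B"
          using f0[of n x] g0[of x] fB[of n x] gB[of x] by (auto simp: u_def)
        have "u powr q = u powr (q - 1) * u"
          using u by (cases "u = 0") (simp_all add: powr_diff)
        also have "\<dots> \<le> B powr (q - 1) * u"
          using u q by (intro mult_right_mono powr_mono2) auto
        finally show "ennreal (\<bar>f n x - g x\<bar> powr q) \<le> ennreal (B powr (q - 1)) * ennreal (norm (f n x - g x))"
          using u by (simp add: u_def ennreal_mult[symmetric] ennreal_leI)
      qed
      then show "(\<integral>\<^sup>+x. ennreal (\<bar>f n x - g x\<bar> powr q) \<partial>lborel)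
        \<le> ennreal (B powr (q - 1)) * (\<integral>\<^sup>+x. ennreal (norm (f n x - g x)) \<partial>lborel)"
        by (simp add: nn_integral_cmult)
    qed
  qed simp
qed (use q in simp)

section \<open>The Gaussian kernel and its Riemann sums\<close>

lemma gauss_kernel_nonneg [simp]: "0 \<le> gauss_kernel \<epsilon> x"
  by (simp add: gauss_kernel_def)

lemma continuous_on_gauss_kernel [continuous_intros]:
  "continuous_on A f \<Longrightarrow> continuous_on A (\<lambda>x. gauss_kernel \<epsilon> (f x))"
  unfolding gauss_kernel_def divide_inverse by (intro continuous_intros)

lemma borel_measurable_gauss_kernel [measurable]: "gauss_kernel \<epsilon> \<in> borel_measurable borel"
  by (intro borel_measurable_continuous_onI continuous_intros)

lemma gauss_kernel_minus [simp]: "gauss_kernel \<epsilon> (- x) = gauss_kernel \<epsilon> x"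
  by (simp add: gauss_kernel_def)

lemma gauss_kernel_commute: "gauss_kernel \<epsilon> (x - y) = gauss_kernel \<epsilon> (y - x)"
  using gauss_kernel_minus[of \<epsilon> "y - x"] by simp

lemma gauss_kernel_le:
  assumes "0 < \<epsilon>"
  shows "gauss_kernel \<epsilon> x \<le> 1 / sqrt \<epsilon>"
proof -
  have "gauss_kernel \<epsilon> x \<le> (2 * pi * \<epsilon>) powr (- 1 / 2) * 1"
    unfolding gauss_kernel_def using assms by (intro mult_left_mono) auto
  also have "\<dots> \<le> \<epsilon> powr (- 1 / 2)"
    using assms pi_ge_two by (simp add: powr_mono2')
  also have "\<dots> = 1 / sqrt \<epsilon>"
    using assms by (simp add: powr_minus powr_half_sqrt inverse_eq_divide)
  finally show ?thesis .
qed

lemma nn_integral_gauss_kernel: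
  assumes "0 < \<epsilon>"
  shows "(\<integral>\<^sup>+x. ennreal (gauss_kernel \<epsilon> (y - x)) \<partial>lborel) = 1"
proof -
  have "(\<integral>\<^sup>+x. ennreal (gauss_kernel \<epsilon> (y - x)) \<partial>lborel) = (\<integral>\<^sup>+x. ennreal (normal_density y (sqrt \<epsilon>) x) \<partial>lborel)"
    using assms
    by (intro nn_integral_cong) (simp add: gauss_kernel_eq_normal_density normal_density_def power2_commute)
  also have "\<dots> = 1"
    using assms by (subst nn_integral_eq_integral) auto
  finally show ?thesis .
qed

text \<open>A left-endpoint Riemann sum for the smoothed local time. The positions form an arbitrary
  sequence, so that sampled paths and the random walk are covered alike.\<close>

definition riemann_local_time :: "(nat \<Rightarrow> real) \<Rightarrow> real \<Rightarrow> real \<Rightarrow> nat \<Rightarrow> real \<Rightarrow> real" where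
  "riemann_local_time S h \<epsilon> K x = h * (\<Sum>j<K. gauss_kernel \<epsilon> (S j - x))"

lemma riemann_local_time_nonneg: "0 \<le> h \<Longrightarrow> 0 \<le> riemann_local_time S h \<epsilon> K x"
  by (simp add: riemann_local_time_def sum_nonneg)

lemma riemann_local_time_le:
  assumes "0 < h" "0 < \<epsilon>"
  shows "riemann_local_time S h \<epsilon> K x \<le> (h * real K) / sqrt \<epsilon>"
proof -
  have "(\<Sum>j<K. gauss_kernel \<epsilon> (S j - x)) \<le> (\<Sum>j<K. 1 / sqrt \<epsilon>)"
    using assms by (intro sum_mono gauss_kernel_le)
  from mult_left_mono[OF this, of h] assms show ?thesis
    by (simp add: riemann_local_time_def)
qed

lemma borel_measurable_riemann_local_time [measurable]:
  "riemann_local_time S h \<epsilon> K \<in> borel_measurable borel"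
  unfolding riemann_local_time_def by measurable

lemma nn_integral_riemann_local_time:
  assumes "0 < h" "0 < \<epsilon>"
  shows "(\<integral>\<^sup>+x. ennreal (riemann_local_time S h \<epsilon> K x) \<partial>lborel) = ennreal (h * real K)"
proof -
  have "(\<integral>\<^sup>+x. ennreal (riemann_local_time S h \<epsilon> K x) \<partial>lborel)
      = (\<integral>\<^sup>+x. ennreal h * (\<Sum>j<K. ennreal (gauss_kernel \<epsilon> (S j - x))) \<partial>lborel)"
    using assms by (simp add: riemann_local_time_def ennreal_mult sum_nonneg)
  also have "\<dots> = ennreal h * (\<Sum>j<K. 1)"
    using assms
    by (simp add: nn_integral_cmult nn_integral_sum nn_integral_gauss_kernel del: sum_ennreal)
  finally show ?thesis
    using assms by (simp add: ennreal_mult ennreal_of_nat_eq_real_of_nat)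
qed

text \<open>On each cell, sum and integral differ by at most \<open>h * e\<close>, where
  \<open>e\<close> bounds the oscillation of \<open>u\<close> at scale \<open>h\<close>; the cells
  add up.\<close>

lemma left_riemann_sum_error:
  fixes u :: "real \<Rightarrow> real"
  assumes cont: "continuous_on {0..t} u" and h: "0 \<le> h" and K: "real K * h \<le> t"
    and e: "\<And>r s. \<lbrakk>r \<in> {0..t}; s \<in> {0..t}; \<bar>r - s\<bar> \<le> h\<rbrakk> \<Longrightarrow> \<bar>u r - u s\<bar> \<le> e"
  shows "\<bar>h * (\<Sum>j<K. u (real j * h)) - integral {0..real K * h} u\<bar> \<le> real K * h * e"
  using K
proof (induction K)
  case 0
  then show ?case by simp
next
  case (Suc K)
  define a b where "a = real K * h" and "b = real (Suc K) * h"
  have ab: "0 \<le> a" "a \<le> b" "b \<le> t" "b - a = h" using Suc.prems h by (auto simp: a_def b_def algebra_simps)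
  have int: "u integrable_on {0..b}" "u integrable_on {a..b}"
    using ab by (auto intro!: integrable_continuous_interval continuous_on_subset[OF cont])
  have IH: "\<bar>h * (\<Sum>j<K. u (real j * h)) - integral {0..a} u\<bar> \<le> real K * h * e"
    using Suc ab by (simp add: a_def b_def)
  have "integral {0..b} u = integral {0..a} u + integral {a..b} u"
    using int ab by (simp add: Henstock_Kurzweil_Integration.integral_combine)
  moreover have "h * u a - integral {a..b} u = integral {a..b} (\<lambda>s. u a - u s)"
    using int ab by (subst integral_diff) auto
  moreover have "\<bar>integral {a..b} (\<lambda>s. u a - u s)\<bar> \<le> e * (b - a)"
    using ab cont
    by (intro integral_bound[where 'a = real, simplified real_norm_def])
      (auto intro!: continuous_intros e intro: continuous_on_subset)
  moreover have "h * (\<Sum>j<Suc K. u (real j * h)) = h * (\<Sum>j<K. u (real j * h)) + h * u a"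
    by (simp add: a_def algebra_simps)
  moreover have "real (Suc K) * h * e = real K * h * e + e * (b - a)"
    using ab(4) by (simp add: algebra_simps)
  ultimately show ?case
    using IH unfolding b_def[symmetric] by linarith
qed

text \<open>The grid need not divide \<open>t\<close>. Uniform continuity compares the sum with the
  integral over the covered interval, and continuity of the indefinite integral then moves the
  endpoint to \<open>t\<close>.\<close>

lemma left_riemann_sum_tendsto:
  fixes u :: "real \<Rightarrow> real"
  assumes cont: "continuous_on {0..t} u" and h: "\<And>m. 0 < h m" "h \<longlonglongrightarrow> 0"
    and K: "\<And>m. real (K m) * h m \<le> t" "(\<lambda>m. real (K m) * h m) \<longlonglongrightarrow> t"
  shows "(\<lambda>m. h m * (\<Sum>j<K m. u (real j * h m))) \<longlonglongrightarrow> integral {0..t} u"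
proof -
  have Kh0: "0 \<le> real (K m) * h m" for m using h(1)[of m] by simp
  have t: "0 \<le> t" using K(1)[of 0] Kh0[of 0] by linarith
  have "uniformly_continuous_on {0..t} u"
    using cont by (intro compact_uniformly_continuous) auto
  then have uc: "\<exists>d>0. \<forall>x\<in>{0..t}. \<forall>y\<in>{0..t}. dist y x < d \<longrightarrow> dist (u y) (u x) < e" if "0 < e" for e
    using that by (auto simp: uniformly_continuous_on_def)
  have "(\<lambda>m. h m * (\<Sum>j<K m. u (real j * h m)) - integral {0..real (K m) * h m} u) \<longlonglongrightarrow> 0"
  proof (rule LIMSEQ_I)
    fix r :: real assume r: "0 < r"
    \<comment> \<open>Dividing by \<open>t + 1\<close> rather than \<open>t\<close> includes the
      case \<open>t = 0\<close>.\<close>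
    define e where "e = r / (t + 1)"
    have e: "0 < e" "t * e < r" using r t by (auto simp: e_def field_simps)
    obtain d where d: "0 < d" "\<And>x y. x \<in> {0..t} \<Longrightarrow> y \<in> {0..t} \<Longrightarrow> dist y x < d \<Longrightarrow> dist (u y) (u x) < e"
      using uc[OF e(1)] by metis
    have "eventually (\<lambda>m. h m < d) sequentially" using h(2) d(1) by (rule order_tendstoD)
    then obtain N where N: "\<And>m. m \<ge> N \<Longrightarrow> h m < d" by (auto simp: eventually_sequentially)
    show "\<exists>no. \<forall>m\<ge>no. norm (h m * (\<Sum>j<K m. u (real j * h m)) - integral {0..real (K m) * h m} u - 0) < r"
    proof (intro exI allI impI)
      fix m assume "m \<ge> N"
      then have hm: "h m < d" using N by auto
      have "\<bar>h m * (\<Sum>j<K m. u (real j * h m)) - integral {0..real (K m) * h m} u\<bar> \<le> real (K m) * h m * e"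
      proof (rule left_riemann_sum_error[OF cont _ K(1)])
        fix r s assume "r \<in> {0..t}" "s \<in> {0..t}" "\<bar>r - s\<bar> \<le> h m"
        then show "\<bar>u r - u s\<bar> \<le> e"
          using d(2)[of s r] hm by (force simp: dist_real_def)
      qed (use h(1)[of m] in simp)
      also have "\<dots> \<le> t * e" using K(1)[of m] e by (intro mult_right_mono) auto
      finally show "norm (h m * (\<Sum>j<K m. u (real j * h m)) - integral {0..real (K m) * h m} u - 0) < r"
        using e by simp
    qed
  qed
  moreover have "(\<lambda>m. integral {0..real (K m) * h m} u) \<longlonglongrightarrow> integral {0..t} u"
  proof -
    have "continuous_on {0..t} (\<lambda>x. integral {0..x} u)"
      using cont by (intro indefinite_integral_continuous_1 integrable_continuous_interval)
    then show ?thesis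
      using K Kh0 t unfolding continuous_on_sequentially by (auto simp: comp_def)
  qed
  ultimately show ?thesis using tendsto_add by fastforce
qed


section \<open>Smoothed local time of a single deterministic path\<close>

definition smoothed_occupation :: "(real \<Rightarrow> real) \<Rightarrow> real \<Rightarrow> real \<Rightarrow> real \<Rightarrow> real" where
  "smoothed_occupation w \<epsilon> t x = (LINT s:{0..t}|lborel. gauss_kernel \<epsilon> (w s - x))"

lemma smoothed_occupation_eq_integral:
  assumes "continuous_on {0..} w"
  shows "smoothed_occupation w \<epsilon> t x = integral {0..t} (\<lambda>s. gauss_kernel \<epsilon> (w s - x))"
  unfolding smoothed_occupation_def
  by (intro set_borel_integral_eq_integral borel_integrable_atLeastAtMost'
      continuous_intros continuous_on_subset[OF assms]) auto

lemma smoothed_occupation_nonneg: "0 \<le> smoothed_occupation w \<epsilon> t x"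
  unfolding smoothed_occupation_def set_lebesgue_integral_def by (intro integral_nonneg_AE) simp

lemma ennreal_smoothed_occupation:
  assumes "continuous_on {0..} w"
  shows "ennreal (smoothed_occupation w \<epsilon> t x)
    = (\<integral>\<^sup>+s. ennreal (gauss_kernel \<epsilon> (w s - x)) * indicator {0..t} s \<partial>lborel)"
proof -
  have "set_integrable lborel {0..t} (\<lambda>s. gauss_kernel \<epsilon> (w s - x))"
    by (intro borel_integrable_atLeastAtMost' continuous_intros continuous_on_subset[OF assms]) auto
  then show ?thesis
    unfolding smoothed_occupation_def set_lebesgue_integral_def set_integrable_def
    by (subst nn_integral_eq_integral[symmetric])
      (auto intro!: nn_integral_cong simp: indicator_def)
qed

text \<open>The path is controlled only on the nonnegative half-line. Cutting it off outside
  \<open>{0..t}\<close> gives a Borel function on the whole line, to which Fubini's theorem and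
  image measures apply.\<close>

lemma borel_measurable_stopped_path:
  fixes w :: "real \<Rightarrow> real"
  assumes "continuous_on {0..} w"
  shows "(\<lambda>s. indicator {0..t} s * w s) \<in> borel_measurable borel"
  using borel_measurable_continuous_on_indicator[of "{0..t}" w] continuous_on_subset[OF assms, of "{0..t}"]
  by auto

lemma borel_measurable_smoothed_occupation:
  assumes "continuous_on {0..} w"
  shows "(\<lambda>x. smoothed_occupation w \<epsilon> t x) \<in> borel_measurable borel"
proof -
  define v where "v s = indicator {0..t} s * w s" for s
  have [measurable]: "v \<in> borel_measurable borel"
    unfolding v_def by (rule borel_measurable_stopped_path[OF assms])
  have "smoothed_occupation w \<epsilon> t x = (LINT s|lborel. indicator {0..t} s * gauss_kernel \<epsilon> (v s - x))" for x
    unfolding smoothed_occupation_def set_lebesgue_integral_def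
    by (intro Bochner_Integration.integral_cong) (auto simp: v_def indicator_def)
  then show ?thesis by simp
qed

lemma nn_integral_smoothed_occupation:
  assumes cont: "continuous_on {0..} w" and "0 < \<epsilon>" "0 \<le> t"
  shows "(\<integral>\<^sup>+x. ennreal (smoothed_occupation w \<epsilon> t x) \<partial>lborel) = ennreal t"
proof -
  define v where "v s = indicator {0..t} s * w s" for s
  have [measurable]: "v \<in> borel_measurable borel"
    unfolding v_def by (rule borel_measurable_stopped_path[OF cont])
  have "(\<integral>\<^sup>+x. ennreal (smoothed_occupation w \<epsilon> t x) \<partial>lborel)
    = (\<integral>\<^sup>+x. (\<integral>\<^sup>+s. ennreal (gauss_kernel \<epsilon> (v s - x)) * indicator {0..t} s \<partial>lborel) \<partial>lborel)"
    unfolding ennreal_smoothed_occupation[OF cont]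
    by (intro nn_integral_cong) (auto simp: v_def indicator_def)
  also have "\<dots> = (\<integral>\<^sup>+s. (\<integral>\<^sup>+x. ennreal (gauss_kernel \<epsilon> (v s - x)) * indicator {0..t} s \<partial>lborel) \<partial>lborel)"
    by (rule lborel_pair.Fubini') measurable
  also have "\<dots> = (\<integral>\<^sup>+s. indicator {0..t} s \<partial>lborel)"
    using assms by (simp add: nn_integral_multc nn_integral_gauss_kernel)
  finally show ?thesis using assms by simp
qed

lemma smoothed_occupation_le:
  assumes cont: "continuous_on {0..} w" and "0 < \<epsilon>" "0 \<le> t"
  shows "smoothed_occupation w \<epsilon> t x \<le> t / sqrt \<epsilon>"
proof -
  have "ennreal (smoothed_occupation w \<epsilon> t x) \<le> (\<integral>\<^sup>+s. ennreal (1 / sqrt \<epsilon>) * indicator {0..t} s \<partial>lborel)"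
    unfolding ennreal_smoothed_occupation[OF cont] using assms
    by (intro nn_integral_mono mult_right_mono ennreal_leI gauss_kernel_le) auto
  also have "\<dots> = ennreal (t / sqrt \<epsilon>)"
    using assms by (simp add: nn_integral_cmult ennreal_mult[symmetric])
  finally show ?thesis using assms by simp
qed

text \<open>Scheffe's argument with masses \<open>real (K m) * h m\<close>, which tend to
  \<open>t\<close>, and the common bound \<open>t / sqrt \<epsilon>\<close>. This bound degenerates
  as \<open>\<epsilon>\<close> tends to 0, so the grid is refined while \<open>\<epsilon>\<close> is
  fixed.\<close>

lemma riemann_local_time_Lq_tendsto:
  assumes cont: "continuous_on {0..} w"
    and h: "\<And>m. 0 < h m" "h \<longlonglongrightarrow> 0"
    and K: "\<And>m. real (K m) * h m \<le> t" "(\<lambda>m. real (K m) * h m) \<longlonglongrightarrow> t"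
    and \<epsilon>: "0 < \<epsilon>" and q: "1 < q"
  shows "(\<lambda>m. Lq_norm q (\<lambda>x. riemann_local_time (\<lambda>j. w (real j * h m)) (h m) \<epsilon> (K m) x
    - smoothed_occupation w \<epsilon> t x)) \<longlonglongrightarrow> 0"
proof (rule Lq_norm_diff_tendsto_0_Scheffe)
  have t: "0 \<le> t" using K(1)[of 0] h(1)[of 0] by (meson dual_order.trans less_imp_le mult_nonneg_nonneg of_nat_0_le_iff)
  show "(\<lambda>x. smoothed_occupation w \<epsilon> t x) \<in> borel_measurable borel"
    by (rule borel_measurable_smoothed_occupation[OF cont])
  show "0 \<le> riemann_local_time (\<lambda>j. w (real j * h m)) (h m) \<epsilon> (K m) x" for m x
    using h(1)[of m] by (intro riemann_local_time_nonneg) simp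
  show "riemann_local_time (\<lambda>j. w (real j * h m)) (h m) \<epsilon> (K m) x \<le> t / sqrt \<epsilon>" for m x
  proof -
    have "riemann_local_time (\<lambda>j. w (real j * h m)) (h m) \<epsilon> (K m) x \<le> (h m * real (K m)) / sqrt \<epsilon>"
      using h \<epsilon> by (intro riemann_local_time_le)
    also have "\<dots> \<le> t / sqrt \<epsilon>" using K(1)[of m] \<epsilon> by (intro divide_right_mono) (auto simp: mult.commute)
    finally show ?thesis .
  qed
  show "smoothed_occupation w \<epsilon> t x \<le> t / sqrt \<epsilon>" for x
    by (rule smoothed_occupation_le[OF cont \<epsilon> t])
  show "(\<lambda>m. riemann_local_time (\<lambda>j. w (real j * h m)) (h m) \<epsilon> (K m) x)
      \<longlonglongrightarrow> smoothed_occupation w \<epsilon> t x" for x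
    unfolding smoothed_occupation_eq_integral[OF cont] riemann_local_time_def
    by (rule left_riemann_sum_tendsto[OF _ h K])
      (intro continuous_intros continuous_on_subset[OF cont], auto)
  show "(\<integral>\<^sup>+x. ennreal (riemann_local_time (\<lambda>j. w (real j * h m)) (h m) \<epsilon> (K m) x) \<partial>lborel)
      = ennreal (real (K m) * h m)" for m
    using h \<epsilon> by (simp add: nn_integral_riemann_local_time mult.commute)
  show "(\<integral>\<^sup>+x. ennreal (smoothed_occupation w \<epsilon> t x) \<partial>lborel) = ennreal t"
    by (rule nn_integral_smoothed_occupation[OF cont \<epsilon> t])
qed (use K q smoothed_occupation_nonneg in auto)

text \<open>Up to time \<open>t\<close> the path stays in a compact interval, so the density
  vanishes almost everywhere outside it, hence everywhere there by continuity. On the interval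
  itself a continuous function is bounded.\<close>

lemma occupation_density_bounded:
  assumes w: "continuous_on {0..} w" and occ: "occupation_density w t l"
    and l: "continuous_on UNIV l"
  obtains B where "\<And>x. l x \<le> B"
proof -
  have l0: "0 \<le> l x" for x using occ by (simp add: occupation_density_def)
  have [measurable]: "l \<in> borel_measurable borel" by (rule borel_measurable_continuous_onI[OF l])
  have "compact (w ` {0..t})"
    by (intro compact_continuous_image continuous_on_subset[OF w]) auto
  then obtain R where R: "\<And>s. s \<in> {0..t} \<Longrightarrow> \<bar>w s\<bar> \<le> R"
    by (metis compact_imp_bounded bounded_iff imageI real_norm_def)
  define A where "A = {y::real. R < \<bar>y\<bar>}"
  have A: "open A" unfolding A_def by (intro open_Collect_less continuous_intros)
  have "(\<integral>\<^sup>+y\<in>A. ennreal (l y) \<partial>lborel) = (\<integral>\<^sup>+s\<in>{0..t}. indicator A (w s) \<partial>lborel)"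
    using occ A by (simp add: occupation_density_def)
  also have "\<dots> = (\<integral>\<^sup>+s. 0 \<partial>(lborel :: real measure))"
  proof (rule nn_integral_cong)
    fix s :: real
    show "(indicator A (w s) :: ennreal) * indicator {0..t} s = 0"
      using R[of s] by (auto simp: A_def indicator_def)
  qed
  finally have "AE y in lborel. ennreal (l y) * indicator A y = 0"
    using A by (subst nn_integral_0_iff_AE[symmetric]) auto
  then have ae: "AE y in lborel. \<not> (y \<in> A \<and> 0 < l y)"
    by eventually_elim (auto simp: indicator_def)
  have zero: "l x = 0" if "x \<in> A" for x
  proof (rule ccontr)
    assume "l x \<noteq> 0"
    then have x: "x \<in> A \<inter> {y. 0 < l y}" using that l0[of x] by auto
    have "open (A \<inter> {y. 0 < l y})"
      by (intro open_Int A open_Collect_less continuous_intros l)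
    then obtain e where e: "0 < e" "cball x e \<subseteq> A \<inter> {y. 0 < l y}"
      using x open_contains_cball by blast
    have "AE y in lborel. y \<notin> cball x e" using ae by eventually_elim (use e in auto)
    then have "emeasure lborel (cball x e) = 0"
      by (subst (asm) AE_iff_measurable[where N = "cball x e"]) auto
    then show False using e by (simp add: cball_eq_atLeastAtMost)
  qed
  have "compact (l ` {- R..R})"
    by (intro compact_continuous_image continuous_on_subset[OF l]) auto
  then obtain B where B: "\<And>x. x \<in> {- R..R} \<Longrightarrow> \<bar>l x\<bar> \<le> B"
    by (metis compact_imp_bounded bounded_iff imageI real_norm_def)
  have "l x \<le> max B 0" for x
  proof (cases "x \<in> A")
    case False
    then have "x \<in> {- R..R}" by (auto simp: A_def)
    then show ?thesis using B[of x] by auto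
  qed (simp add: zero)
  then show thesis by (rule that)
qed

text \<open>The occupation formula for the Gaussian kernel. The definition, which speaks of sets,
  identifies the image of Lebesgue measure on \<open>{0..t}\<close> under the path with the measure
  of density \<open>l\<close>; then the kernel is integrated against both.\<close>

lemma smoothed_occupation_eq_convolution:
  assumes cont: "continuous_on {0..} w" and occ: "occupation_density w t l"
    and [measurable]: "l \<in> borel_measurable borel"
  shows "ennreal (smoothed_occupation w \<epsilon> t x)
    = (\<integral>\<^sup>+y. ennreal (l y) * ennreal (gauss_kernel \<epsilon> (y - x)) \<partial>lborel)"
proof -
  define v where "v s = indicator {0..t} s * w s" for s
  have [measurable]: "v \<in> borel_measurable borel"
    unfolding v_def by (rule borel_measurable_stopped_path[OF cont])
  define N where "N = density lborel (indicator {0..t} :: real \<Rightarrow> ennreal)"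
  have [measurable]: "v \<in> measurable N borel" by (simp add: N_def)
  have eq: "distr N borel v = density lborel (\<lambda>y. ennreal (l y))"
  proof (rule measure_eqI)
    fix A assume "A \<in> sets (distr N borel v)"
    then have A[measurable]: "A \<in> sets borel" by simp
    have "emeasure (distr N borel v) A = (\<integral>\<^sup>+y. indicator A y \<partial>distr N borel v)" by simp
    also have "\<dots> = (\<integral>\<^sup>+s. indicator A (v s) \<partial>N)"
      by (subst nn_integral_distr) auto
    also have "\<dots> = (\<integral>\<^sup>+s. indicator {0..t} s * indicator A (v s) \<partial>lborel)"
      unfolding N_def by (subst nn_integral_density) auto
    also have "\<dots> = (\<integral>\<^sup>+s\<in>{0..t}. indicator A (w s) \<partial>lborel)"
      by (intro nn_integral_cong) (auto simp: v_def indicator_def)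
    also have "\<dots> = (\<integral>\<^sup>+x\<in>A. ennreal (l x) \<partial>lborel)"
      using occ A by (simp add: occupation_density_def)
    also have "\<dots> = emeasure (density lborel (\<lambda>y. ennreal (l y))) A"
      by (simp add: emeasure_density)
    finally show "emeasure (distr N borel v) A = emeasure (density lborel (\<lambda>y. ennreal (l y))) A" .
  qed simp
  have "ennreal (smoothed_occupation w \<epsilon> t x)
      = (\<integral>\<^sup>+s. indicator {0..t} s * ennreal (gauss_kernel \<epsilon> (v s - x)) \<partial>lborel)"
    unfolding ennreal_smoothed_occupation[OF cont]
    by (intro nn_integral_cong) (auto simp: v_def indicator_def)
  also have "\<dots> = (\<integral>\<^sup>+s. ennreal (gauss_kernel \<epsilon> (v s - x)) \<partial>N)"
    unfolding N_def by (subst nn_integral_density) auto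
  also have "\<dots> = (\<integral>\<^sup>+y. ennreal (gauss_kernel \<epsilon> (y - x)) \<partial>distr N borel v)"
    by (subst nn_integral_distr) auto
  also have "\<dots> = (\<integral>\<^sup>+y. ennreal (l y) * ennreal (gauss_kernel \<epsilon> (y - x)) \<partial>lborel)"
    unfolding eq by (subst nn_integral_density) auto
  finally show ?thesis .
qed

lemma gauss_kernel_scale:
  assumes "0 < \<epsilon>"
  shows "sqrt \<epsilon> * gauss_kernel \<epsilon> (sqrt \<epsilon> * z) = gauss_kernel 1 z"
  using assms
  by (simp add: gauss_kernel_eq_normal_density normal_density_def real_sqrt_mult power_mult_distrib)

text \<open>Smoothing preserves the total mass \<open>t\<close> and the upper bound of
  \<open>l\<close>, so Scheffe's argument reduces the claim to pointwise convergence.\<close>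

lemma smoothed_occupation_Lq_tendsto:
  assumes cont: "continuous_on {0..} w" and occ: "occupation_density w t l"
    and l: "continuous_on UNIV l" and t: "0 \<le> t"
    and \<eta>: "\<And>k. 0 < \<eta> k" "\<eta> \<longlonglongrightarrow> 0" and q: "1 < q"
  shows "(\<lambda>k. Lq_norm q (\<lambda>x. smoothed_occupation w (\<eta> k) t x - l x)) \<longlonglongrightarrow> 0"
proof -
  have l0: "0 \<le> l x" for x using occ by (simp add: occupation_density_def)
  have [measurable]: "l \<in> borel_measurable borel" by (rule borel_measurable_continuous_onI[OF l])
  obtain B where B: "\<And>x. l x \<le> B" using occupation_density_bounded[OF cont occ l] by blast
  note conv = smoothed_occupation_eq_convolution[OF cont occ \<open>l \<in> borel_measurable borel\<close>]
  have le_B: "smoothed_occupation w (\<eta> k) t x \<le> B" for k x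
  proof -
    have "ennreal (smoothed_occupation w (\<eta> k) t x)
        \<le> (\<integral>\<^sup>+y. ennreal B * ennreal (gauss_kernel (\<eta> k) (x - y)) \<partial>lborel)"
      unfolding conv gauss_kernel_commute[of _ x]
      by (intro nn_integral_mono mult_right_mono ennreal_leI B) auto
    also have "\<dots> = ennreal B"
      using \<eta> by (simp add: nn_integral_cmult nn_integral_gauss_kernel)
    finally show ?thesis using l0[of 0] B[of 0] by (simp add: ennreal_le_iff)
  qed
  have "(\<lambda>k. smoothed_occupation w (\<eta> k) t x) \<longlonglongrightarrow> l x" for x
  proof -
    have gk1: "(\<integral>\<^sup>+z. ennreal c * ennreal (gauss_kernel 1 z) \<partial>lborel) = ennreal c" for c
      using nn_integral_gauss_kernel[of 1 0] by (simp add: nn_integral_cmult)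
    \<comment> \<open>The substitution \<open>y = x + sqrt (\<eta> k) * z\<close> replaces the
      shrinking kernel by a fixed one, which serves as the dominating function up to the factor
      \<open>B\<close>.\<close>
    have eq: "ennreal (smoothed_occupation w (\<eta> k) t x)
        = (\<integral>\<^sup>+z. ennreal (l (x + sqrt (\<eta> k) * z)) * ennreal (gauss_kernel 1 z) \<partial>lborel)" for k
    proof -
      have "ennreal (smoothed_occupation w (\<eta> k) t x)
        = ennreal (sqrt (\<eta> k)) * (\<integral>\<^sup>+z. ennreal (l (x + sqrt (\<eta> k) * z))
            * ennreal (gauss_kernel (\<eta> k) (x + sqrt (\<eta> k) * z - x)) \<partial>lborel)"
        unfolding conv using \<eta>(1)[of k]
        by (subst nn_integral_real_affine[where c = "sqrt (\<eta> k)" and t = x]) auto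
      also have "\<dots> = (\<integral>\<^sup>+z. ennreal (l (x + sqrt (\<eta> k) * z)) * ennreal (gauss_kernel 1 z) \<partial>lborel)"
        using \<eta>(1)[of k]
        by (subst nn_integral_cmult[symmetric])
          (auto simp flip: gauss_kernel_scale[OF \<eta>(1)[of k]] simp: ennreal_mult ac_simps
            intro!: nn_integral_cong)
      finally show ?thesis .
    qed
    have "(\<lambda>k. \<integral>\<^sup>+z. ennreal (l (x + sqrt (\<eta> k) * z)) * ennreal (gauss_kernel 1 z) \<partial>lborel)
        \<longlonglongrightarrow> (\<integral>\<^sup>+z. ennreal (l x) * ennreal (gauss_kernel 1 z) \<partial>lborel)"
    proof (rule nn_integral_dominated_convergence[where w = "\<lambda>z. ennreal B * ennreal (gauss_kernel 1 z)"])
      show "AE z in lborel. (\<lambda>k. ennreal (l (x + sqrt (\<eta> k) * z)) * ennreal (gauss_kernel 1 z))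
          \<longlonglongrightarrow> ennreal (l x) * ennreal (gauss_kernel 1 z)"
      proof (rule AE_I2)
        fix z
        have "(\<lambda>k. x + sqrt (\<eta> k) * z) \<longlonglongrightarrow> x + sqrt 0 * z" by (intro tendsto_intros \<eta>)
        then have "(\<lambda>k. l (x + sqrt (\<eta> k) * z)) \<longlonglongrightarrow> l x"
          using l by (intro continuous_on_tendsto_compose[OF l]) auto
        then show "(\<lambda>k. ennreal (l (x + sqrt (\<eta> k) * z)) * ennreal (gauss_kernel 1 z))
          \<longlonglongrightarrow> ennreal (l x) * ennreal (gauss_kernel 1 z)"
          by (simp add: ennreal_mult[symmetric] l0 tendsto_intros)
      qed
    qed (auto simp: gk1 intro!: mult_right_mono ennreal_leI B)
    then have "(\<lambda>k. ennreal (smoothed_occupation w (\<eta> k) t x)) \<longlonglongrightarrow> ennreal (l x)"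
      unfolding eq gk1 .
    then show ?thesis
      by (rule tendsto_ennrealD) (simp_all add: l0 smoothed_occupation_nonneg)
  qed
  moreover have "(\<integral>\<^sup>+x. ennreal (l x) \<partial>lborel) = ennreal t"
    using occ t unfolding occupation_density_def
    by (auto dest!: bspec[of _ _ UNIV])
  ultimately show ?thesis
    by (intro Lq_norm_diff_tendsto_0_Scheffe[where B = B and c = "\<lambda>_. t" and d = t])
      (use l0 B q le_B smoothed_occupation_nonneg borel_measurable_smoothed_occupation[OF cont]
        nn_integral_smoothed_occupation[OF cont \<eta>(1) t] in auto)
qed

section \<open>Exponential moments for the Gaussian random walk\<close>

definition gauss_step :: "real \<Rightarrow> real measure" where
  "gauss_step h = density lborel (\<lambda>x. ennreal (normal_density 0 (sqrt h) x))"

text \<open>An infinite product is used because it splits again into copies of itself, after any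
  number of steps (\<open>comb_seq\<close>) or after the first one
  (\<open>case_nat\<close>).\<close>

abbreviation walk_space :: "real \<Rightarrow> (nat \<Rightarrow> real) measure" where
  "walk_space h \<equiv> \<Pi>\<^sub>M i\<in>UNIV. gauss_step h"

definition walk :: "(nat \<Rightarrow> real) \<Rightarrow> nat \<Rightarrow> real" where
  "walk \<omega> j = (\<Sum>i<j. \<omega> i)"

lemma sets_gauss_step [measurable_cong, simp]: "sets (gauss_step h) = sets borel"
  by (simp add: gauss_step_def)

lemma sequence_space_gauss_step: "0 < h \<Longrightarrow> sequence_space (gauss_step h)"
  unfolding gauss_step_def sequence_space_def product_prob_space_def product_prob_space_axioms_def
    product_sigma_finite_def
  by (auto intro!: prob_space_normal_density prob_space_imp_sigma_finite)

lemma prob_space_walk_space: "0 < h \<Longrightarrow> prob_space (walk_space h)"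
proof -
  assume "0 < h"
  then interpret sequence_space "gauss_step h" by (rule sequence_space_gauss_step)
  show ?thesis by unfold_locales
qed

lemma measurable_walk [measurable]: "(\<lambda>\<omega>. walk \<omega> j) \<in> borel_measurable (walk_space h)"
  unfolding walk_def by measurable

lemma walk_comb_seq_le: "j \<le> k \<Longrightarrow> walk (comb_seq k \<omega> \<omega>') j = walk \<omega> j"
  by (auto simp: walk_def comb_seq_less intro!: sum.cong)

lemma walk_comb_seq_add: "walk (comb_seq k \<omega> \<omega>') (k + j) = walk \<omega> k + walk \<omega>' j"
proof -
  have "walk (comb_seq k \<omega> \<omega>') (k + j) = (\<Sum>i<k. comb_seq k \<omega> \<omega>' i) + (\<Sum>i<j. comb_seq k \<omega> \<omega>' (i + k))"
    unfolding walk_def by (induction j) (simp_all add: add_ac)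
  then show ?thesis
    using walk_comb_seq_le[of k k \<omega> \<omega>'] by (simp add: comb_seq_add walk_def)
qed

text \<open>The Markov property at step \<open>k\<close>: the later increments form an independent
  copy of the whole walk.\<close>

lemma nn_integral_walk_space_comb_seq:
  assumes h: "0 < h" and [measurable]: "F \<in> borel_measurable (walk_space h)"
  shows "(\<integral>\<^sup>+\<omega>. F \<omega> \<partial>walk_space h)
    = (\<integral>\<^sup>+\<omega>. (\<integral>\<^sup>+\<omega>'. F (comb_seq k \<omega> \<omega>') \<partial>walk_space h) \<partial>walk_space h)"
proof -
  interpret sequence_space "gauss_step h" using h by (rule sequence_space_gauss_step)
  have "(\<integral>\<^sup>+\<omega>. F \<omega> \<partial>walk_space h)
      = (\<integral>\<^sup>+p. F (case p of (\<omega>, \<omega>') \<Rightarrow> comb_seq k \<omega> \<omega>') \<partial>(walk_space h \<Otimes>\<^sub>M walk_space h))"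
    by (subst PiM_comb_seq[of k, symmetric], subst nn_integral_distr) auto
  also have "\<dots> = (\<integral>\<^sup>+\<omega>. (\<integral>\<^sup>+\<omega>'. F (comb_seq k \<omega> \<omega>') \<partial>walk_space h) \<partial>walk_space h)"
    by (subst P.nn_integral_fst[symmetric]) auto
  finally show ?thesis .
qed

text \<open>First-step decomposition, the form of the Markov property behind Khas'minskii's
  recursion.\<close>

lemma nn_integral_walk_space_Suc:
  assumes h: "0 < h" and [measurable]: "F \<in> borel_measurable (walk_space h)"
  shows "(\<integral>\<^sup>+\<omega>. F \<omega> \<partial>walk_space h)
    = (\<integral>\<^sup>+z. (\<integral>\<^sup>+\<omega>. F (case_nat z \<omega>) \<partial>walk_space h) \<partial>gauss_step h)"
proof -
  interpret sequence_space "gauss_step h" using h by (rule sequence_space_gauss_step)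
  have "(\<integral>\<^sup>+\<omega>. F \<omega> \<partial>walk_space h)
      = (\<integral>\<^sup>+p. F (case p of (z, \<omega>) \<Rightarrow> case_nat z \<omega>) \<partial>(gauss_step h \<Otimes>\<^sub>M walk_space h))"
    by (subst PiM_iter[symmetric], subst nn_integral_distr) auto
  also have "\<dots> = (\<integral>\<^sup>+z. (\<integral>\<^sup>+\<omega>. F (case_nat z \<omega>) \<partial>walk_space h) \<partial>gauss_step h)"
    by (subst P.nn_integral_fst[symmetric]) auto
  finally show ?thesis .
qed

lemma walk_case_nat_0: "walk (case_nat z \<omega>) 0 = 0"
  and walk_case_nat_Suc: "walk (case_nat z \<omega>) (Suc j) = z + walk \<omega> j"
  by (simp_all add: walk_def sum.lessThan_Suc_shift del: sum.lessThan_Suc)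

lemma riemann_local_time_case_nat:
  "riemann_local_time (walk (case_nat z \<omega>)) h \<epsilon> (Suc k) x
    = h * gauss_kernel \<epsilon> x + riemann_local_time (walk \<omega>) h \<epsilon> k (x - z)"
  unfolding riemann_local_time_def sum.lessThan_Suc_shift
  by (simp add: walk_case_nat_0 walk_case_nat_Suc algebra_simps)

lemma measurable_riemann_local_time_walk [measurable (raw)]:
  assumes [measurable]: "f \<in> measurable N (walk_space h')" "g \<in> borel_measurable N"
  shows "(\<lambda>p. riemann_local_time (walk (f p)) h \<epsilon> k (g p)) \<in> borel_measurable N"
proof -
  have [measurable]: "(\<lambda>p. walk (f p) j) \<in> borel_measurable N" for j
    by (rule measurable_compose[OF assms(1) measurable_walk])
  show ?thesis unfolding riemann_local_time_def by measurable
qed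

section \<open>Khas'minskii's lemma for the smoothed random walk\<close>

lemma nn_integral_gauss_kernel_gauss_step:
  assumes "0 < \<epsilon>" "0 < h"
  shows "(\<integral>\<^sup>+z. ennreal (gauss_kernel \<epsilon> (x - z)) \<partial>gauss_step h) = ennreal (gauss_kernel (\<epsilon> + h) x)"
proof -
  have "(\<integral>\<^sup>+z. ennreal (gauss_kernel \<epsilon> (x - z)) \<partial>gauss_step h)
      = (\<integral>\<^sup>+z. ennreal (normal_density 0 (sqrt \<epsilon>) (x - z) * normal_density 0 (sqrt h) z) \<partial>lborel)"
    unfolding gauss_step_def using assms
    by (subst nn_integral_density)
      (auto intro!: nn_integral_cong simp: gauss_kernel_eq_normal_density ennreal_mult[symmetric] mult.commute)
  also have "\<dots> = ennreal (normal_density 0 (sqrt (\<epsilon> + h)) x)"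
    using fun_cong[OF conv_normal_density_zero_mean[of "sqrt \<epsilon>" "sqrt h"], of x] assms by simp
  finally show ?thesis using assms by (simp add: gauss_kernel_eq_normal_density)
qed

text \<open>A bound for the discrete Green function, uniform in \<open>x\<close>. The term
  \<open>j = 0\<close> has only the smoothing variance; for \<open>j > 0\<close> the variance is at
  least \<open>real j * h\<close>, and the sum is compared with the integral of
  \<open>1 / sqrt s\<close>.\<close>

lemma sum_gauss_kernel_le:
  assumes "0 < \<epsilon>" "0 < h"
  shows "h * (\<Sum>j<k. gauss_kernel (\<epsilon> + real j * h) x) \<le> h / sqrt \<epsilon> + 2 * sqrt (real k * h)"
proof -
  have Suc_bound: "h * (\<Sum>j<Suc n. gauss_kernel (\<epsilon> + real j * h) x) \<le> h / sqrt \<epsilon> + 2 * sqrt (real n * h)" for n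
  proof (induction n)
    case 0
    have "h * gauss_kernel \<epsilon> x \<le> h * (1 / sqrt \<epsilon>)"
      using assms by (intro mult_left_mono gauss_kernel_le) auto
    then show ?case by simp
  next
    case (Suc n)
    define a b where "a = sqrt (real n * h)" and "b = sqrt (real (Suc n) * h)"
    have ab: "0 \<le> a" "0 < b" using assms by (auto simp: a_def b_def)
    have sq: "h = b * b - a * a" using assms by (simp add: a_def b_def algebra_simps)
    have "gauss_kernel (\<epsilon> + real (Suc n) * h) x \<le> 1 / sqrt (\<epsilon> + real (Suc n) * h)"
      using assms by (intro gauss_kernel_le) (simp add: add_pos_nonneg)
    also have "\<dots> \<le> 1 / b"
      unfolding b_def using assms
      by (intro divide_left_mono real_sqrt_le_mono mult_pos_pos) (auto simp: add_pos_nonneg)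
    finally have "h * gauss_kernel (\<epsilon> + real (Suc n) * h) x \<le> h * (1 / b)"
      using assms by (intro mult_left_mono) auto
    \<comment> \<open>The integral comparison in telescoping form: \<open>2 * (b - a)\<close> is the
      integral of \<open>1 / sqrt s\<close> over the last cell.\<close>
    also have "\<dots> \<le> 2 * (b - a)"
    proof -
      have "0 \<le> (b - a) * (b - a)" by simp
      then have "h \<le> 2 * (b - a) * b" unfolding sq by (simp add: algebra_simps)
      then show ?thesis using ab by (simp add: field_simps)
    qed
    finally have "h * gauss_kernel (\<epsilon> + real (Suc n) * h) x \<le> 2 * (b - a)" .
    then have "h * (\<Sum>j<Suc n. gauss_kernel (\<epsilon> + real j * h) x) + h * gauss_kernel (\<epsilon> + real (Suc n) * h) x
        \<le> (h / sqrt \<epsilon> + 2 * a) + 2 * (b - a)"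
      using Suc.IH unfolding a_def by (intro add_mono)
    then show ?case
      by (subst sum.lessThan_Suc) (simp only: distrib_left b_def[symmetric], simp)
  qed
  show ?thesis
  proof (cases k)
    case 0
    then show ?thesis using assms by simp
  next
    case (Suc n)
    have "sqrt (real n * h) \<le> sqrt (real (Suc n) * h)" using assms by simp
    then show ?thesis unfolding Suc by (intro order_trans[OF Suc_bound[of n]]) simp
  qed
qed

text \<open>
  Khas'minskii's argument: the increment of the exponential functional at the first step is at most its
  drift at that step times the full exponential, and the Gaussian semigroup adds up the drifts.
\<close>

lemma walk_exp_moment_le:
  assumes \<epsilon>: "0 < \<epsilon>" and h: "0 < h" and \<theta>: "0 < \<theta>"
    and V: "\<And>i x. i \<le> k \<Longrightarrow>
      (\<integral>\<^sup>+\<omega>. ennreal (exp (\<theta> * riemann_local_time (walk \<omega>) h \<epsilon> i x)) \<partial>walk_space h) \<le> V"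
  shows "(\<integral>\<^sup>+\<omega>. ennreal (exp (\<theta> * riemann_local_time (walk \<omega>) h \<epsilon> k x) - 1) \<partial>walk_space h)
    \<le> V * ennreal (\<theta> * (h * (\<Sum>j<k. gauss_kernel (\<epsilon> + real j * h) x)))"
  using V
proof (induction k arbitrary: x)
  case 0
  then show ?case by (simp add: riemann_local_time_def)
next
  case (Suc k)
  interpret S: prob_space "walk_space h" by (rule prob_space_walk_space[OF h])
  let ?X = "\<lambda>k \<omega> x. riemann_local_time (walk \<omega>) h \<epsilon> k x"
  define c where "c = \<theta> * (h * gauss_kernel \<epsilon> x)"
  have c0: "0 \<le> c" using \<theta> h by (simp add: c_def)
  \<comment> \<open>With \<open>E\<close> the full exponential and \<open>b\<close> the one without
    the first site, so that \<open>E = exp c * b\<close>, this is \<open>E - b \<le> c * E\<close>,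
    a consequence of \<open>1 - c \<le> exp (- c)\<close>. Keeping \<open>E\<close> on the right is
    what produces the factor \<open>V\<close>.\<close>
  have step: "exp (\<theta> * ?X (Suc k) (case_nat z \<omega>) x) - 1
      \<le> (exp (\<theta> * ?X k \<omega> (x - z)) - 1) + c * exp (\<theta> * ?X (Suc k) (case_nat z \<omega>) x)" for z \<omega>
  proof -
    let ?b = "exp (\<theta> * ?X k \<omega> (x - z))"
    have "1 - c \<le> exp (- c)" using exp_ge_add_one_self[of "- c"] by simp
    then have "exp c * ?b * (1 - c) \<le> exp c * ?b * exp (- c)" by (intro mult_left_mono) auto
    also have "\<dots> = ?b" by (simp add: exp_minus)
    finally have "exp c * ?b - c * (exp c * ?b) \<le> ?b" by (simp add: algebra_simps)
    moreover have eq: "exp (\<theta> * ?X (Suc k) (case_nat z \<omega>) x) = exp c * ?b"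
      unfolding riemann_local_time_case_nat c_def by (simp add: distrib_left exp_add)
    ultimately show ?thesis unfolding eq by simp
  qed
  have X0: "0 \<le> ?X k \<omega> x" for k \<omega> x using h by (intro riemann_local_time_nonneg) simp
  have step': "ennreal (exp (\<theta> * ?X (Suc k) (case_nat z \<omega>) x) - 1)
      \<le> ennreal (exp (\<theta> * ?X k \<omega> (x - z)) - 1) + ennreal c * ennreal (exp (\<theta> * ?X (Suc k) (case_nat z \<omega>) x))" for z \<omega>
    using step[of z \<omega>] c0 X0 \<theta>
    by (simp add: ennreal_mult[symmetric] ennreal_plus[symmetric] ennreal_leI del: ennreal_plus)
  have "(\<integral>\<^sup>+\<omega>. ennreal (exp (\<theta> * ?X (Suc k) \<omega> x) - 1) \<partial>walk_space h)
      = (\<integral>\<^sup>+z. (\<integral>\<^sup>+\<omega>. ennreal (exp (\<theta> * ?X (Suc k) (case_nat z \<omega>) x) - 1) \<partial>walk_space h) \<partial>gauss_step h)"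
    by (rule nn_integral_walk_space_Suc[OF h]) measurable
  also have "\<dots> \<le> (\<integral>\<^sup>+z. (\<integral>\<^sup>+\<omega>. ennreal (exp (\<theta> * ?X k \<omega> (x - z)) - 1)
      + ennreal c * ennreal (exp (\<theta> * ?X (Suc k) (case_nat z \<omega>) x)) \<partial>walk_space h) \<partial>gauss_step h)"
    by (intro nn_integral_mono step')
  also have "\<dots> = (\<integral>\<^sup>+z. (\<integral>\<^sup>+\<omega>. ennreal (exp (\<theta> * ?X k \<omega> (x - z)) - 1) \<partial>walk_space h)
      + ennreal c * (\<integral>\<^sup>+\<omega>. ennreal (exp (\<theta> * ?X (Suc k) (case_nat z \<omega>) x)) \<partial>walk_space h) \<partial>gauss_step h)"
    by (intro nn_integral_cong) (simp add: nn_integral_add nn_integral_cmult)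
  also have "\<dots> = (\<integral>\<^sup>+z. (\<integral>\<^sup>+\<omega>. ennreal (exp (\<theta> * ?X k \<omega> (x - z)) - 1) \<partial>walk_space h) \<partial>gauss_step h)
      + ennreal c * (\<integral>\<^sup>+z. (\<integral>\<^sup>+\<omega>. ennreal (exp (\<theta> * ?X (Suc k) (case_nat z \<omega>) x)) \<partial>walk_space h) \<partial>gauss_step h)"
    by (simp add: nn_integral_add nn_integral_cmult)
  also have "\<dots> \<le> V * (ennreal (\<theta> * h) * (\<Sum>j<k. ennreal (gauss_kernel (\<epsilon> + real (Suc j) * h) x))) + ennreal c * V"
  proof (intro add_mono mult_left_mono)
    have "(\<integral>\<^sup>+z. (\<integral>\<^sup>+\<omega>. ennreal (exp (\<theta> * ?X (Suc k) (case_nat z \<omega>) x)) \<partial>walk_space h) \<partial>gauss_step h)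
      = (\<integral>\<^sup>+\<omega>. ennreal (exp (\<theta> * ?X (Suc k) \<omega> x)) \<partial>walk_space h)"
      by (rule nn_integral_walk_space_Suc[OF h, symmetric]) measurable
    also have "\<dots> \<le> V" using Suc.prems by simp
    finally show "(\<integral>\<^sup>+z. (\<integral>\<^sup>+\<omega>. ennreal (exp (\<theta> * ?X (Suc k) (case_nat z \<omega>) x)) \<partial>walk_space h) \<partial>gauss_step h) \<le> V" .
  next
    have "(\<integral>\<^sup>+z. (\<integral>\<^sup>+\<omega>. ennreal (exp (\<theta> * ?X k \<omega> (x - z)) - 1) \<partial>walk_space h) \<partial>gauss_step h)
        \<le> (\<integral>\<^sup>+z. V * (ennreal (\<theta> * h) * (\<Sum>j<k. ennreal (gauss_kernel (\<epsilon> + real j * h) (x - z)))) \<partial>gauss_step h)"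
    proof (rule nn_integral_mono)
      fix z
      have "(\<integral>\<^sup>+\<omega>. ennreal (exp (\<theta> * ?X k \<omega> (x - z)) - 1) \<partial>walk_space h)
          \<le> V * ennreal (\<theta> * (h * (\<Sum>j<k. gauss_kernel (\<epsilon> + real j * h) (x - z))))"
        using Suc.prems by (intro Suc.IH) simp
      then show "(\<integral>\<^sup>+\<omega>. ennreal (exp (\<theta> * ?X k \<omega> (x - z)) - 1) \<partial>walk_space h)
        \<le> V * (ennreal (\<theta> * h) * (\<Sum>j<k. ennreal (gauss_kernel (\<epsilon> + real j * h) (x - z))))"
        using \<theta> h by (simp add: ennreal_mult sum_nonneg mult.assoc)
    qed
    \<comment> \<open>Averaging over the first step adds \<open>h\<close> to every variance, hence
      the shift from \<open>j\<close> to \<open>Suc j\<close>.\<close>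
    also have "\<dots> = V * (ennreal (\<theta> * h) * (\<Sum>j<k. ennreal (gauss_kernel (\<epsilon> + real (Suc j) * h) x)))"
    proof -
      have "0 < \<epsilon> + real j * h" for j using \<epsilon> h by (simp add: add_pos_nonneg)
      then show ?thesis
        using h by (simp add: nn_integral_cmult nn_integral_sum nn_integral_gauss_kernel_gauss_step
            algebra_simps del: sum_ennreal)
    qed
    finally show "(\<integral>\<^sup>+z. (\<integral>\<^sup>+\<omega>. ennreal (exp (\<theta> * ?X k \<omega> (x - z)) - 1) \<partial>walk_space h) \<partial>gauss_step h)
        \<le> V * (ennreal (\<theta> * h) * (\<Sum>j<k. ennreal (gauss_kernel (\<epsilon> + real (Suc j) * h) x)))" .
  qed simp
  also have "\<dots> = V * (ennreal (\<theta> * (h * (\<Sum>j<k. gauss_kernel (\<epsilon> + real (Suc j) * h) x))) + ennreal c)"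
    using \<theta> h by (simp add: ennreal_mult sum_nonneg distrib_left mult.assoc mult.commute[of _ V])
  \<comment> \<open>The drift \<open>c\<close> of the first site is the summand with
    \<open>j = 0\<close>.\<close>
  also have "ennreal (\<theta> * (h * (\<Sum>j<k. gauss_kernel (\<epsilon> + real (Suc j) * h) x))) + ennreal c
      = ennreal (\<theta> * (h * (\<Sum>j<Suc k. gauss_kernel (\<epsilon> + real j * h) x)))"
    unfolding sum.lessThan_Suc_shift using \<theta> h c0
    by (subst ennreal_plus[symmetric]) (auto simp: sum_nonneg c_def algebra_simps)
  finally show ?case .
qed

text \<open>With \<open>V\<close> the supremum over \<open>x\<close> of the moment, the preceding
  bound gives \<open>V \<le> 1 + V / 2\<close>. Absorbing the last term requires \<open>V\<close> to
  be finite, which the crude bound of the sums by \<open>h * real k / sqrt \<epsilon>\<close>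
  supplies; the resulting bound 2 is free of \<open>\<epsilon>\<close>.\<close>

lemma walk_exp_moment_le_two:
  assumes \<epsilon>: "0 < \<epsilon>" and h: "0 < h" and \<theta>: "0 < \<theta>"
    and small: "\<theta> * (h / sqrt \<epsilon> + 2 * sqrt (real k * h)) \<le> 1 / 2"
  shows "(\<integral>\<^sup>+\<omega>. ennreal (exp (\<theta> * riemann_local_time (walk \<omega>) h \<epsilon> k x)) \<partial>walk_space h) \<le> 2"
proof -
  interpret S: prob_space "walk_space h" by (rule prob_space_walk_space[OF h])
  let ?X = "\<lambda>k \<omega> x. riemann_local_time (walk \<omega>) h \<epsilon> k x"
  define v where "v k x = (\<integral>\<^sup>+\<omega>. ennreal (exp (\<theta> * ?X k \<omega> x)) \<partial>walk_space h)" for k x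
  define V where "V = (SUP x. v k x)"
  have "v k x \<le> ennreal (exp (\<theta> * (h * real k / sqrt \<epsilon>)))" for x
  proof -
    have "v k x \<le> (\<integral>\<^sup>+\<omega>. ennreal (exp (\<theta> * (h * real k / sqrt \<epsilon>))) \<partial>walk_space h)"
      unfolding v_def using \<theta> h \<epsilon>
      by (intro nn_integral_mono ennreal_leI iffD2[OF exp_le_cancel_iff] mult_left_mono
          riemann_local_time_le) auto
    then show ?thesis by (simp add: S.emeasure_space_1)
  qed
  then have "V \<le> ennreal (exp (\<theta> * (h * real k / sqrt \<epsilon>)))"
    unfolding V_def by (intro SUP_least)
  then have V_fin: "V < top" by (simp add: order_le_less_trans)
  \<comment> \<open>Shorter sums are smaller, so the supremum at full length also serves every
    shorter length, as the recursion demands.\<close>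
  have vV: "v i x \<le> V" if "i \<le> k" for i x
  proof -
    have "?X i \<omega> x \<le> ?X k \<omega> x" for \<omega>
      unfolding riemann_local_time_def using that h by (intro mult_left_mono sum_mono2) auto
    then have "v i x \<le> v k x" unfolding v_def using \<theta> by (intro nn_integral_mono ennreal_leI) simp
    also have "\<dots> \<le> V" unfolding V_def by (rule SUP_upper) simp
    finally show ?thesis .
  qed
  have X0: "0 \<le> ?X k \<omega> x" for k \<omega> x using h by (intro riemann_local_time_nonneg) simp
  have "v k x \<le> 1 + V * ennreal (1 / 2)" for x
  proof -
    have "v k x = (\<integral>\<^sup>+\<omega>. 1 + ennreal (exp (\<theta> * ?X k \<omega> x) - 1) \<partial>walk_space h)"
      unfolding v_def using X0 \<theta>
      by (intro nn_integral_cong) (simp add: ennreal_plus[symmetric] flip: ennreal_1 del: ennreal_plus)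
    also have "\<dots> = 1 + (\<integral>\<^sup>+\<omega>. ennreal (exp (\<theta> * ?X k \<omega> x) - 1) \<partial>walk_space h)"
      by (subst nn_integral_add) (auto simp: S.emeasure_space_1)
    also have "\<dots> \<le> 1 + V * ennreal (\<theta> * (h * (\<Sum>j<k. gauss_kernel (\<epsilon> + real j * h) x)))"
      using vV by (intro add_left_mono walk_exp_moment_le \<epsilon> h \<theta>) (simp add: v_def)
    also have "\<dots> \<le> 1 + V * ennreal (1 / 2)"
    proof (intro add_left_mono mult_left_mono ennreal_leI)
      have "\<theta> * (h * (\<Sum>j<k. gauss_kernel (\<epsilon> + real j * h) x)) \<le> \<theta> * (h / sqrt \<epsilon> + 2 * sqrt (real k * h))"
        using \<theta> by (intro mult_left_mono sum_gauss_kernel_le \<epsilon> h) auto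
      with small show "\<theta> * (h * (\<Sum>j<k. gauss_kernel (\<epsilon> + real j * h) x)) \<le> 1 / 2" by linarith
    qed simp
    finally show ?thesis .
  qed
  then have *: "V \<le> 1 + V * ennreal (1 / 2)" unfolding V_def by (intro SUP_least)
  obtain r where r: "V = ennreal r" "0 \<le> r" using V_fin by (cases V) auto
  define c :: real where "c = 1 / 2"
  have c: "0 \<le> c" "1 + r * c = 1 + r / 2" by (simp_all add: c_def)
  have "ennreal r \<le> ennreal (1 + r * c)"
    using * r(2) c(1) unfolding r(1) c_def[symmetric] by (simp add: ennreal_mult)
  then have "r \<le> 1 + r * c"
    using r(2) c(1) by (subst (asm) ennreal_le_iff) auto
  then have "r \<le> 1 + r / 2" unfolding c(2) .
  then have "r \<le> 2" by simp
  then have "V \<le> 2" using r by (metis ennreal_leI ennreal_numeral)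
  with vV[of k x] show ?thesis unfolding v_def by (meson order.trans order_refl)
qed

text \<open>The pathwise bound \<open>exp_Lq_norm_le\<close> is averaged, and Fubini's theorem
  brings in the pointwise moments. Their bound is a sum of probability densities in
  \<open>x\<close>, so it integrates to at most \<open>4 * \<Lambda>\<close>, and the prefactor
  \<open>1 / \<Lambda>\<close> leaves the constant 4.\<close>

lemma walk_exp_Lq_norm_le:
  assumes \<epsilon>: "0 < \<epsilon>" and h: "0 < h" and \<Lambda>: "0 < \<Lambda>" and q: "1 < q"
    and small: "2 * \<Lambda> * (h / sqrt \<epsilon> + 2 * sqrt (real k * h)) \<le> 1 / 2"
    and mass: "h * real k \<le> 1"
  shows "(\<integral>\<^sup>+\<omega>. ennreal_exp (ennreal \<Lambda> * Lq_norm q (riemann_local_time (walk \<omega>) h \<epsilon> k)) \<partial>walk_space h)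
    \<le> ennreal (exp (\<Lambda> * max 2 ((q - 1) / \<Lambda>)) + 4)"
proof -
  interpret S: prob_space "walk_space h" by (rule prob_space_walk_space[OF h])
  interpret P: pair_sigma_finite "walk_space h" lborel ..
  let ?X = "\<lambda>k \<omega> x. riemann_local_time (walk \<omega>) h \<epsilon> k x"
  define C where "C = exp (\<Lambda> * max 2 ((q - 1) / \<Lambda>))"
  have X0: "0 \<le> ?X k \<omega> x" for k \<omega> x using h by (intro riemann_local_time_nonneg) simp
  have "(\<integral>\<^sup>+\<omega>. ennreal_exp (ennreal \<Lambda> * Lq_norm q (?X k \<omega>)) \<partial>walk_space h)
      \<le> (\<integral>\<^sup>+\<omega>. ennreal C + ennreal (1 / \<Lambda>) * (\<integral>\<^sup>+x. ennreal (exp (2 * \<Lambda> * ?X k \<omega> x) - 1) \<partial>lborel) \<partial>walk_space h)"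
    unfolding C_def
    by (intro nn_integral_mono exp_Lq_norm_le[where B = "h * real k / sqrt \<epsilon>"] borel_measurable_riemann_local_time
        X0 riemann_local_time_le h \<epsilon> q \<Lambda>)
      (use mass h \<epsilon> in \<open>simp add: nn_integral_riemann_local_time\<close>)
  also have "\<dots> = ennreal C + ennreal (1 / \<Lambda>) *
      (\<integral>\<^sup>+\<omega>. (\<integral>\<^sup>+x. ennreal (exp (2 * \<Lambda> * ?X k \<omega> x) - 1) \<partial>lborel) \<partial>walk_space h)"
    by (simp add: nn_integral_add nn_integral_cmult S.emeasure_space_1)
  also have "\<dots> \<le> ennreal C + ennreal (1 / \<Lambda>) * ennreal (4 * \<Lambda>)"
  proof (intro add_left_mono mult_left_mono)
    have "(\<integral>\<^sup>+\<omega>. (\<integral>\<^sup>+x. ennreal (exp (2 * \<Lambda> * ?X k \<omega> x) - 1) \<partial>lborel) \<partial>walk_space h)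
        = (\<integral>\<^sup>+x. (\<integral>\<^sup>+\<omega>. ennreal (exp (2 * \<Lambda> * ?X k \<omega> x) - 1) \<partial>walk_space h) \<partial>lborel)"
      by (rule P.Fubini'[symmetric]) measurable
    \<comment> \<open>Here \<open>4 * \<Lambda>\<close> is \<open>V * \<theta>\<close> with
      \<open>V = 2\<close> and \<open>\<theta> = 2 * \<Lambda>\<close>.\<close>
    also have "\<dots> \<le> (\<integral>\<^sup>+x. ennreal (4 * \<Lambda> * h) * (\<Sum>j<k. ennreal (gauss_kernel (\<epsilon> + real j * h) (0 - x))) \<partial>lborel)"
    proof (rule nn_integral_mono)
      fix x
      have "2 * \<Lambda> * (h / sqrt \<epsilon> + 2 * sqrt (real i * h)) \<le> 1 / 2" if "i \<le> k" for i
      proof -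
        have "h / sqrt \<epsilon> + 2 * sqrt (real i * h) \<le> h / sqrt \<epsilon> + 2 * sqrt (real k * h)"
          using that h by (simp add: mult_right_mono)
        then have "2 * \<Lambda> * (h / sqrt \<epsilon> + 2 * sqrt (real i * h)) \<le> 2 * \<Lambda> * (h / sqrt \<epsilon> + 2 * sqrt (real k * h))"
          using \<Lambda> by (intro mult_left_mono) auto
        with small show ?thesis by linarith
      qed
      then have "(\<integral>\<^sup>+\<omega>. ennreal (exp (2 * \<Lambda> * ?X k \<omega> x) - 1) \<partial>walk_space h)
          \<le> 2 * ennreal (2 * \<Lambda> * (h * (\<Sum>j<k. gauss_kernel (\<epsilon> + real j * h) x)))"
        using \<Lambda> by (intro walk_exp_moment_le walk_exp_moment_le_two \<epsilon> h) auto
      also have "\<dots> = ennreal (2 * (2 * \<Lambda> * (h * (\<Sum>j<k. gauss_kernel (\<epsilon> + real j * h) x))))"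
        using \<Lambda> h by (subst ennreal_mult) (auto simp: sum_nonneg)
      also have "\<dots> = ennreal (4 * \<Lambda> * h * (\<Sum>j<k. gauss_kernel (\<epsilon> + real j * h) (0 - x)))"
        by (simp add: algebra_simps)
      finally show "(\<integral>\<^sup>+\<omega>. ennreal (exp (2 * \<Lambda> * ?X k \<omega> x) - 1) \<partial>walk_space h)
          \<le> ennreal (4 * \<Lambda> * h) * (\<Sum>j<k. ennreal (gauss_kernel (\<epsilon> + real j * h) (0 - x)))"
        using \<Lambda> h by (simp add: ennreal_mult sum_nonneg)
    qed
    also have "\<dots> = ennreal (4 * \<Lambda> * h) * (\<Sum>j<k. 1)"
    proof -
      have "0 < \<epsilon> + real j * h" for j using \<epsilon> h by (simp add: add_pos_nonneg)
      then have "(\<integral>\<^sup>+x. ennreal (gauss_kernel (\<epsilon> + real j * h) (0 - x)) \<partial>lborel) = 1" for j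
        by (rule nn_integral_gauss_kernel)
      then show ?thesis
        by (subst nn_integral_cmult, simp) (subst nn_integral_sum, simp, simp del: sum_ennreal diff_0)
    qed
    also have "\<dots> = ennreal (4 * \<Lambda> * (h * real k))"
      using \<Lambda> h by (simp add: ennreal_mult ennreal_of_nat_eq_real_of_nat mult.assoc)
    also have "\<dots> \<le> ennreal (4 * \<Lambda>)"
      using \<Lambda> mass by (intro ennreal_leI) simp
    finally show "(\<integral>\<^sup>+\<omega>. (\<integral>\<^sup>+x. ennreal (exp (2 * \<Lambda> * ?X k \<omega> x) - 1) \<partial>lborel) \<partial>walk_space h) \<le> ennreal (4 * \<Lambda>)" .
  qed simp
  also have "\<dots> = ennreal (C + 4)"
    using \<Lambda> by (subst ennreal_plus) (auto simp: ennreal_mult[symmetric] C_def)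
  finally show ?thesis unfolding C_def .
qed

section \<open>Moments of the difference between two levels of smoothing\<close>

definition riemann_diff :: "(nat \<Rightarrow> real) \<Rightarrow> real \<Rightarrow> real \<Rightarrow> real \<Rightarrow> nat \<Rightarrow> real \<Rightarrow> real" where
  "riemann_diff S h \<eta> \<epsilon> K x = riemann_local_time S h \<eta> K x - riemann_local_time S h \<epsilon> K x"

lemma borel_measurable_riemann_diff [measurable]: "riemann_diff S h \<eta> \<epsilon> K \<in> borel_measurable borel"
  unfolding riemann_diff_def by measurable

definition walk_diff_moment :: "real \<Rightarrow> real \<Rightarrow> real \<Rightarrow> real \<Rightarrow> real \<Rightarrow> nat \<Rightarrow> ennreal" where
  "walk_diff_moment q c h \<eta> \<epsilon> K
    = (\<integral>\<^sup>+\<omega>. ennreal_exp (ennreal c * Lq_norm q (riemann_diff (walk \<omega>) h \<eta> \<epsilon> K)) \<partial>walk_space h)"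

lemma measurable_Lq_norm_riemann_diff_walk [measurable (raw)]:
  assumes [measurable]: "f \<in> measurable N (walk_space h')"
  shows "(\<lambda>p. Lq_norm q (riemann_diff (walk (f p)) h \<eta> \<epsilon> K)) \<in> borel_measurable N"
  unfolding riemann_diff_def by measurable

text \<open>This is the second-moment bound for uniform integrability, so the exponent is
  \<open>2 * c\<close>. Separating the two terms raises it to \<open>4 * c\<close>, and
  \<open>walk_exp_Lq_norm_le\<close> then asks for smallness at \<open>8 * c\<close>. The bound does
  not depend on \<open>\<eta>\<close>, \<open>\<epsilon>\<close> or the mesh.\<close>

lemma walk_diff_moment_two_le:
  assumes \<eta>: "0 < \<eta>" and \<epsilon>: "0 < \<epsilon>" and h: "0 < h" and c: "0 < c" and q: "1 < q"
    and small: "8 * c * (h / sqrt \<eta> + 2 * sqrt (real k * h)) \<le> 1 / 2"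
      "8 * c * (h / sqrt \<epsilon> + 2 * sqrt (real k * h)) \<le> 1 / 2"
    and mass: "h * real k \<le> 1"
  shows "walk_diff_moment q (2 * c) h \<eta> \<epsilon> k \<le> ennreal (2 * (exp (4 * c * max 2 ((q - 1) / (4 * c))) + 4))"
proof -
  let ?X = "\<lambda>\<epsilon> \<omega>. riemann_local_time (walk \<omega>) h \<epsilon> k"
  let ?B = "exp (4 * c * max 2 ((q - 1) / (4 * c))) + 4"
  have "walk_diff_moment q (2 * c) h \<eta> \<epsilon> k
      \<le> (\<integral>\<^sup>+\<omega>. ennreal_exp (ennreal (4 * c) * Lq_norm q (?X \<eta> \<omega>))
          + ennreal_exp (ennreal (4 * c) * Lq_norm q (?X \<epsilon> \<omega>)) \<partial>walk_space h)"
    unfolding walk_diff_moment_def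
  proof (rule nn_integral_mono)
    fix \<omega>
    have "Lq_norm q (riemann_diff (walk \<omega>) h \<eta> \<epsilon> k) \<le> Lq_norm q (?X \<eta> \<omega>) + Lq_norm q (?X \<epsilon> \<omega>)"
      unfolding riemann_diff_def using q by (intro Lq_norm_diff_le) auto
    then have "ennreal (2 * c) * Lq_norm q (riemann_diff (walk \<omega>) h \<eta> \<epsilon> k)
        \<le> ennreal (2 * c) * Lq_norm q (?X \<eta> \<omega>) + ennreal (2 * c) * Lq_norm q (?X \<epsilon> \<omega>)"
      by (metis mult_left_mono distrib_left zero_le)
    then have "ennreal_exp (ennreal (2 * c) * Lq_norm q (riemann_diff (walk \<omega>) h \<eta> \<epsilon> k))
        \<le> ennreal_exp (ennreal (2 * c) * Lq_norm q (?X \<eta> \<omega>) + ennreal (2 * c) * Lq_norm q (?X \<epsilon> \<omega>))"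
      by (rule ennreal_exp_mono)
    also have "\<dots> \<le> ennreal_exp (2 * (ennreal (2 * c) * Lq_norm q (?X \<eta> \<omega>)))
        + ennreal_exp (2 * (ennreal (2 * c) * Lq_norm q (?X \<epsilon> \<omega>)))"
      by (rule ennreal_exp_add_le)
    also have "\<dots> = ennreal_exp (ennreal (4 * c) * Lq_norm q (?X \<eta> \<omega>))
        + ennreal_exp (ennreal (4 * c) * Lq_norm q (?X \<epsilon> \<omega>))"
    proof -
      have "ennreal (4 * c) = 2 * ennreal (2 * c)"
        using c by (subst ennreal_numeral[symmetric], subst ennreal_mult[symmetric]) auto
      then show ?thesis by (simp add: mult.assoc)
    qed
    finally show "ennreal_exp (ennreal (2 * c) * Lq_norm q (riemann_diff (walk \<omega>) h \<eta> \<epsilon> k))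
        \<le> ennreal_exp (ennreal (4 * c) * Lq_norm q (?X \<eta> \<omega>)) + ennreal_exp (ennreal (4 * c) * Lq_norm q (?X \<epsilon> \<omega>))" .
  qed
  also have "\<dots> = (\<integral>\<^sup>+\<omega>. ennreal_exp (ennreal (4 * c) * Lq_norm q (?X \<eta> \<omega>)) \<partial>walk_space h)
      + (\<integral>\<^sup>+\<omega>. ennreal_exp (ennreal (4 * c) * Lq_norm q (?X \<epsilon> \<omega>)) \<partial>walk_space h)"
    by (rule nn_integral_add) measurable
  also have "\<dots> \<le> ennreal ?B + ennreal ?B"
    using c small mass by (intro add_mono walk_exp_Lq_norm_le \<eta> \<epsilon> h q) auto
  also have "\<dots> = ennreal (2 * ?B)"
    by (simp add: ennreal_plus[symmetric] del: ennreal_plus)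
  finally show ?thesis .
qed

lemma walk_diff_moment_mono: "c \<le> c' \<Longrightarrow> walk_diff_moment q c h \<eta> \<epsilon> k \<le> walk_diff_moment q c' h \<eta> \<epsilon> k"
  unfolding walk_diff_moment_def
  by (intro nn_integral_mono ennreal_exp_mono mult_right_mono ennreal_leI) auto

lemma riemann_local_time_comb_seq:
  "riemann_local_time (walk (comb_seq k \<omega> \<omega>')) h \<epsilon> (k + l) x
    = riemann_local_time (walk \<omega>) h \<epsilon> k x + riemann_local_time (walk \<omega>') h \<epsilon> l (x - walk \<omega> k)"
proof -
  have "(\<Sum>j<k + l. gauss_kernel \<epsilon> (walk (comb_seq k \<omega> \<omega>') j - x))
      = (\<Sum>j<k. gauss_kernel \<epsilon> (walk \<omega> j - x)) + (\<Sum>j<l. gauss_kernel \<epsilon> (walk \<omega>' j - (x - walk \<omega> k)))"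
  proof (induction l)
    case 0
    then show ?case by (simp add: walk_comb_seq_le)
  next
    case (Suc l)
    have "gauss_kernel \<epsilon> (walk \<omega> k + walk \<omega>' l - x) = gauss_kernel \<epsilon> (walk \<omega>' l - (x - walk \<omega> k))"
      by (rule arg_cong[of _ _ "gauss_kernel \<epsilon>"]) simp
    with Suc show ?case by (simp add: walk_comb_seq_add)
  qed
  then show ?thesis by (simp add: riemann_local_time_def distrib_left)
qed

lemma walk_diff_moment_add_le:
  assumes h: "0 < h" and q: "1 < q"
  shows "walk_diff_moment q c h \<eta> \<epsilon> (k + l) \<le> walk_diff_moment q c h \<eta> \<epsilon> k * walk_diff_moment q c h \<eta> \<epsilon> l"
proof -
  let ?E = "\<lambda>k \<omega>. ennreal_exp (ennreal c * Lq_norm q (riemann_diff (walk \<omega>) h \<eta> \<epsilon> k))"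
  have le: "?E (k + l) (comb_seq k \<omega> \<omega>') \<le> ?E k \<omega> * ?E l \<omega>'" for \<omega> \<omega>'
  proof -
    let ?f = "riemann_diff (walk \<omega>) h \<eta> \<epsilon> k" and ?g = "riemann_diff (walk \<omega>') h \<eta> \<epsilon> l"
    have "riemann_diff (walk (comb_seq k \<omega> \<omega>')) h \<eta> \<epsilon> (k + l) = (\<lambda>x. ?f x + ?g (x - walk \<omega> k))"
      by (simp add: fun_eq_iff riemann_diff_def riemann_local_time_comb_seq)
    then have "Lq_norm q (riemann_diff (walk (comb_seq k \<omega> \<omega>')) h \<eta> \<epsilon> (k + l))
        \<le> Lq_norm q ?f + Lq_norm q (\<lambda>x. ?g (x - walk \<omega> k))"
      using q by (simp add: Lq_norm_triangle)
    \<comment> \<open>The shift \<open>walk \<omega> k\<close> couples the second block to the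
      first; translation invariance removes it, so the exponential factorises over independent
      blocks.\<close>
    also have "\<dots> = Lq_norm q ?f + Lq_norm q ?g"
      by (subst Lq_norm_translate) auto
    finally have "ennreal c * Lq_norm q (riemann_diff (walk (comb_seq k \<omega> \<omega>')) h \<eta> \<epsilon> (k + l))
        \<le> ennreal c * Lq_norm q ?f + ennreal c * Lq_norm q ?g"
      by (metis mult_left_mono distrib_left zero_le)
    then show ?thesis
      unfolding ennreal_exp_add[symmetric] by (rule ennreal_exp_mono)
  qed
  have "walk_diff_moment q c h \<eta> \<epsilon> (k + l)
      = (\<integral>\<^sup>+\<omega>. (\<integral>\<^sup>+\<omega>'. ?E (k + l) (comb_seq k \<omega> \<omega>') \<partial>walk_space h) \<partial>walk_space h)"
    unfolding walk_diff_moment_def by (rule nn_integral_walk_space_comb_seq[OF h]) measurable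
  also have "\<dots> \<le> (\<integral>\<^sup>+\<omega>. (\<integral>\<^sup>+\<omega>'. ?E k \<omega> * ?E l \<omega>' \<partial>walk_space h) \<partial>walk_space h)"
    by (intro nn_integral_mono le)
  also have "\<dots> = walk_diff_moment q c h \<eta> \<epsilon> k * walk_diff_moment q c h \<eta> \<epsilon> l"
    unfolding walk_diff_moment_def by (simp add: nn_integral_cmult nn_integral_multc)
  finally show ?thesis .
qed

lemma walk_diff_moment_le_power:
  assumes "0 < h" "1 < q"
  shows "walk_diff_moment q c h \<eta> \<epsilon> (n * m + k)
    \<le> walk_diff_moment q c h \<eta> \<epsilon> m ^ n * walk_diff_moment q c h \<eta> \<epsilon> k"
proof (induction n)
  case 0
  then show ?case by simp
next
  case (Suc n)
  have "walk_diff_moment q c h \<eta> \<epsilon> (Suc n * m + k)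
      \<le> walk_diff_moment q c h \<eta> \<epsilon> m * walk_diff_moment q c h \<eta> \<epsilon> (n * m + k)"
    using walk_diff_moment_add_le[OF assms, of c \<eta> \<epsilon> m "n * m + k"] by (simp add: add.assoc)
  also have "\<dots> \<le> walk_diff_moment q c h \<eta> \<epsilon> m *
      (walk_diff_moment q c h \<eta> \<epsilon> m ^ n * walk_diff_moment q c h \<eta> \<epsilon> k)"
    by (intro mult_left_mono Suc.IH) simp
  finally show ?case by (simp add: mult.assoc)
qed

section \<open>Brownian motion\<close>

text \<open>The assumption gives independence of finite initial segments of increments. Independence
  of an infinite family is tested on finite subfamilies, each contained in such a segment, so the
  joint law is the infinite product.\<close>

lemma (in standard_brownian_motion) distr_increments:
  assumes h: "0 < h"
  shows "distr M (walk_space h) (\<lambda>\<omega> i. W (real (Suc i) * h) \<omega> - W (real i * h) \<omega>) = walk_space h"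
proof -
  define \<xi> where "\<xi> i \<omega> = W (real (Suc i) * h) \<omega> - W (real i * h) \<omega>" for i :: nat and \<omega>
  have rv[measurable]: "\<xi> i \<in> borel_measurable M" for i
    unfolding \<xi>_def using h by (intro borel_measurable_diff random_variable) auto
  have law: "distr M borel (\<xi> i) = gauss_step h" for i
  proof -
    have "distributed M lborel (\<xi> i) (normal_density 0 (sqrt (real (Suc i) * h - real i * h)))"
      unfolding \<xi>_def using h by (intro gaussian_increments) auto
    then have "distr M lborel (\<xi> i) = density lborel (normal_density 0 (sqrt h))"
      by (simp add: distributed_distr_eq_density algebra_simps)
    moreover have "distr M lborel (\<xi> i) = distr M borel (\<xi> i)" by (rule distr_cong) auto
    ultimately show ?thesis by (simp add: gauss_step_def)
  qed
  have ind: "indep_vars (\<lambda>_. borel) \<xi> {..<n}" for n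
    unfolding \<xi>_def using h
    by (intro independent_increments[where \<tau> = "\<lambda>i. real i * h"]) (auto simp: mult_right_mono)
  have "indep_vars (\<lambda>_. borel) \<xi> UNIV"
    unfolding indep_vars_def
  proof (intro conjI ballI)
    show "indep_sets (\<lambda>i. sigma_sets (space M) {\<xi> i -` A \<inter> space M |A. A \<in> sets borel}) UNIV"
    proof (subst indep_sets_finite_index_sets, intro allI impI)
      fix J :: "nat set" assume "finite J"
      then obtain n where "J \<subseteq> {..<n}" by (auto simp: finite_nat_set_iff_bounded)
      moreover have "indep_sets (\<lambda>i. sigma_sets (space M) {\<xi> i -` A \<inter> space M |A. A \<in> sets borel}) {..<n}"
        using ind[of n] by (simp add: indep_vars_def)
      ultimately show "indep_sets (\<lambda>i. sigma_sets (space M) {\<xi> i -` A \<inter> space M |A. A \<in> sets borel}) J"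
        by (rule indep_sets_mono_index)
    qed
  qed (use rv in auto)
  then have "distr M (\<Pi>\<^sub>M i\<in>UNIV. borel) (\<lambda>\<omega>. \<lambda>i\<in>UNIV. \<xi> i \<omega>) = (\<Pi>\<^sub>M i\<in>UNIV. distr M borel (\<xi> i))"
    by (subst (asm) indep_vars_iff_distr_eq_PiM) auto
  moreover have "distr M (\<Pi>\<^sub>M i\<in>UNIV. borel) (\<lambda>\<omega>. \<lambda>i\<in>UNIV. \<xi> i \<omega>) = distr M (walk_space h) (\<lambda>\<omega> i. \<xi> i \<omega>)"
    by (rule distr_cong) (auto intro!: sets_PiM_cong)
  ultimately show ?thesis by (simp add: law \<xi>_def)
qed

lemma measurable_riemann_diff [measurable (raw)]:
  assumes [measurable]: "\<And>j. (\<lambda>\<omega>. S \<omega> j) \<in> borel_measurable N"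
  shows "(\<lambda>\<omega>. Lq_norm q (riemann_diff (S \<omega>) h \<eta> \<epsilon> K)) \<in> borel_measurable N"
  unfolding riemann_diff_def riemann_local_time_def by measurable

text \<open>Almost surely \<open>W\<close> starts at 0, so the sampled positions are the partial
  sums of the increments, whose joint law is that of the steps of the walk.\<close>

lemma (in standard_brownian_motion) walk_diff_moment_eq:
  assumes h: "0 < h"
  shows "(\<integral>\<^sup>+\<omega>. ennreal_exp (ennreal c * Lq_norm q (riemann_diff (\<lambda>j. W (real j * h) \<omega>) h \<eta> \<epsilon> K)) \<partial>M)
    = walk_diff_moment q c h \<eta> \<epsilon> K"
proof -
  let ?\<xi> = "\<lambda>\<omega> i. W (real (Suc i) * h) \<omega> - W (real i * h) \<omega>"
  have [measurable]: "W (real i * h) \<in> borel_measurable M" for i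
    using h by (intro random_variable) auto
  have \<xi>[measurable]: "?\<xi> \<in> measurable M (walk_space h)"
    by (rule measurable_PiM_single') (auto simp: gauss_step_def simp del: of_nat_Suc)
  have telescope: "walk (?\<xi> \<omega>) j = W (real j * h) \<omega> - W 0 \<omega>" for \<omega> j
    unfolding walk_def using sum_lessThan_telescope[of "\<lambda>i. W (real i * h) \<omega>" j] by simp
  have "(\<integral>\<^sup>+\<omega>. ennreal_exp (ennreal c * Lq_norm q (riemann_diff (\<lambda>j. W (real j * h) \<omega>) h \<eta> \<epsilon> K)) \<partial>M)
      = (\<integral>\<^sup>+\<omega>. ennreal_exp (ennreal c * Lq_norm q (riemann_diff (walk (?\<xi> \<omega>)) h \<eta> \<epsilon> K)) \<partial>M)"
  proof (rule nn_integral_cong_AE)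
    show "AE \<omega> in M. ennreal_exp (ennreal c * Lq_norm q (riemann_diff (\<lambda>j. W (real j * h) \<omega>) h \<eta> \<epsilon> K))
      = ennreal_exp (ennreal c * Lq_norm q (riemann_diff (walk (?\<xi> \<omega>)) h \<eta> \<epsilon> K))"
      using starts_at_0
    proof eventually_elim
      case (elim \<omega>)
      then have "walk (?\<xi> \<omega>) = (\<lambda>j. W (real j * h) \<omega>)" by (simp only: fun_eq_iff telescope) simp
      then show ?case by simp
    qed
  qed
  also have "\<dots> = (\<integral>\<^sup>+\<omega>. ennreal_exp (ennreal c * Lq_norm q (riemann_diff (walk \<omega>) h \<eta> \<epsilon> K))
      \<partial>distr M (walk_space h) ?\<xi>)"
    by (rule nn_integral_distr[OF \<xi>, symmetric]) measurable
  also have "\<dots> = walk_diff_moment q c h \<eta> \<epsilon> K"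
    unfolding distr_increments[OF h] walk_diff_moment_def ..
  finally show ?thesis .
qed

text \<open>
  Reverse Fatou, applied twice to the truncation at level \<open>B\<close>; the second moments control the
  part above \<open>B\<close>.
\<close>

lemma (in prob_space) double_limsup_moment_le:
  fixes Y :: "nat \<Rightarrow> nat \<Rightarrow> 'a \<Rightarrow> ennreal"
  assumes meas[measurable]: "\<And>k m. Y k m \<in> borel_measurable M"
    and lim: "AE \<omega> in M. \<forall>c>1. \<forall>\<^sub>F k in sequentially. \<forall>\<^sub>F m in sequentially. Y k m \<omega> \<le> ennreal c"
    and bd: "\<And>k. \<forall>\<^sub>F m in sequentially. (\<integral>\<^sup>+\<omega>. Y k m \<omega> * Y k m \<omega> \<partial>M) \<le> ennreal C"
    and C: "0 \<le> C" and \<rho>: "0 < \<rho>"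
  shows "\<forall>\<^sub>F k in sequentially. \<forall>\<^sub>F m in sequentially. (\<integral>\<^sup>+\<omega>. Y k m \<omega> \<partial>M) \<le> ennreal (1 + \<rho>)"
proof -
  \<comment> \<open>The level makes the contribution above it, at most \<open>C / B\<close>, no
    larger than \<open>\<rho> / 2\<close>; the added 1 keeps it positive when
    \<open>C = 0\<close>.\<close>
  define B where "B = 2 * C / \<rho> + 1"
  have B: "0 < B" "1 / B * C \<le> \<rho> / 2"
    using C \<rho> by (auto simp: B_def field_simps add_pos_nonneg add_nonneg_pos)
  define T where "T k m \<omega> = min (Y k m \<omega>) (ennreal B)" for k m \<omega>
  have [measurable]: "T k m \<in> borel_measurable M" for k m unfolding T_def by measurable
  have TB: "T k m \<omega> \<le> ennreal B" for k m \<omega> by (simp add: T_def)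
  have Z_meas[measurable]: "(\<lambda>\<omega>. limsup (\<lambda>m. T k m \<omega>)) \<in> borel_measurable M" for k by measurable
  have inner: "limsup (\<lambda>m. \<integral>\<^sup>+\<omega>. T k m \<omega> \<partial>M) \<le> (\<integral>\<^sup>+\<omega>. limsup (\<lambda>m. T k m \<omega>) \<partial>M)" for k
    by (rule nn_integral_limsup[where w = "\<lambda>_. ennreal B"]) (auto simp: TB emeasure_space_1)
  have "limsup (\<lambda>k. \<integral>\<^sup>+\<omega>. limsup (\<lambda>m. T k m \<omega>) \<partial>M) \<le> (\<integral>\<^sup>+\<omega>. limsup (\<lambda>k. limsup (\<lambda>m. T k m \<omega>)) \<partial>M)"
    by (rule nn_integral_limsup[where w = "\<lambda>_. ennreal B"])
      (auto simp: emeasure_space_1 intro!: Limsup_bounded always_eventually TB)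
  also have "\<dots> \<le> (\<integral>\<^sup>+\<omega>. 1 \<partial>M)"
  proof (rule nn_integral_mono_AE)
    show "AE \<omega> in M. limsup (\<lambda>k. limsup (\<lambda>m. T k m \<omega>)) \<le> 1"
      using lim
    proof eventually_elim
      case (elim \<omega>)
      show ?case
      proof (rule ennreal_le_epsilon)
        fix e :: real assume e: "0 < e"
        have "\<forall>\<^sub>F k in sequentially. limsup (\<lambda>m. T k m \<omega>) \<le> ennreal (1 + e)"
          using elim[rule_format, of "1 + e"] e
          by (auto elim!: eventually_mono intro!: Limsup_bounded simp: T_def min.coboundedI1)
        then have "limsup (\<lambda>k. limsup (\<lambda>m. T k m \<omega>)) \<le> ennreal (1 + e)"
          by (rule Limsup_bounded)
        then show "limsup (\<lambda>k. limsup (\<lambda>m. T k m \<omega>)) \<le> 1 + ennreal e" using e by simp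
      qed
    qed
  qed
  also have "\<dots> = 1" by (simp add: emeasure_space_1)
  also have "1 < ennreal (1 + \<rho> / 2)" using \<rho> by simp
  finally have "\<forall>\<^sub>F k in sequentially. (\<integral>\<^sup>+\<omega>. limsup (\<lambda>m. T k m \<omega>) \<partial>M) < ennreal (1 + \<rho> / 2)"
    by (rule Limsup_lessD)
  then show ?thesis
  proof eventually_elim
    case (elim k)
    then have "limsup (\<lambda>m. \<integral>\<^sup>+\<omega>. T k m \<omega> \<partial>M) < ennreal (1 + \<rho> / 2)"
      using inner[of k] by (rule le_less_trans[rotated])
    then have "\<forall>\<^sub>F m in sequentially. (\<integral>\<^sup>+\<omega>. T k m \<omega> \<partial>M) < ennreal (1 + \<rho> / 2)"
      by (rule Limsup_lessD)
    with bd[of k] show ?case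
    proof eventually_elim
      case (elim m)
      have "(\<integral>\<^sup>+\<omega>. Y k m \<omega> \<partial>M) \<le> (\<integral>\<^sup>+\<omega>. T k m \<omega> + ennreal (1 / B) * (Y k m \<omega> * Y k m \<omega>) \<partial>M)"
      proof (rule nn_integral_mono)
        fix \<omega>
        show "Y k m \<omega> \<le> T k m \<omega> + ennreal (1 / B) * (Y k m \<omega> * Y k m \<omega>)"
        proof (cases "Y k m \<omega> \<le> ennreal B")
          case True
          then show ?thesis by (simp add: T_def)
        next
          case False
          show ?thesis
          proof (cases "Y k m \<omega>")
            case (real y)
            then have "B < y" using False B by (simp add: not_le)
            then have "y \<le> 1 / B * (y * y)" using B by (simp add: field_simps)
            then have "ennreal y \<le> ennreal (1 / B) * (ennreal y * ennreal y)"
              using B real by (simp add: ennreal_mult[symmetric] ennreal_leI)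
            then show ?thesis unfolding real by (meson add_increasing zero_le)
          next
            case top
            then show ?thesis using B by (simp add: ennreal_mult_top)
          qed
        qed
      qed
      also have "\<dots> = (\<integral>\<^sup>+\<omega>. T k m \<omega> \<partial>M) + ennreal (1 / B) * (\<integral>\<^sup>+\<omega>. Y k m \<omega> * Y k m \<omega> \<partial>M)"
        by (simp add: nn_integral_add nn_integral_cmult)
      also have "\<dots> \<le> ennreal (1 + \<rho> / 2) + ennreal (1 / B) * ennreal C"
        using elim by (intro add_mono mult_left_mono) auto
      also have "\<dots> = ennreal (1 + \<rho> / 2 + 1 / B * C)"
        using B C \<rho> by (simp add: ennreal_mult[symmetric] ennreal_plus[symmetric] del: ennreal_plus)
      also have "\<dots> \<le> ennreal (1 + \<rho>)"
        using B by (intro ennreal_leI) linarith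
      finally show ?case .
    qed
  qed
qed

text \<open>Fatou's lemma is applied in \<open>m\<close> for each \<open>k\<close>, then in
  \<open>k\<close>. \<open>Z\<close> enters only through an almost sure majorant built from the
  measurable \<open>Y k m\<close>, so the norm of the local time difference can be inserted as it
  stands. The factor \<open>a\<close> allows for slack in the pathwise comparison.\<close>

lemma (in prob_space) double_fatou_le:
  fixes Y :: "nat \<Rightarrow> nat \<Rightarrow> 'a \<Rightarrow> ennreal"
  assumes meas[measurable]: "\<And>k m. Y k m \<in> borel_measurable M"
    and lim: "AE \<omega> in M. \<forall>\<^sub>F k in sequentially. \<forall>\<^sub>F m in sequentially. Z \<omega> \<le> a * Y k m \<omega>"
    and bd: "\<forall>\<^sub>F k in sequentially. \<forall>\<^sub>F m in sequentially. (\<integral>\<^sup>+\<omega>. Y k m \<omega> \<partial>M) \<le> b"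
  shows "(\<integral>\<^sup>+\<omega>. Z \<omega> \<partial>M) \<le> a * b"
proof -
  have "(\<integral>\<^sup>+\<omega>. Z \<omega> \<partial>M) \<le> (\<integral>\<^sup>+\<omega>. liminf (\<lambda>k. liminf (\<lambda>m. a * Y k m \<omega>)) \<partial>M)"
  proof (rule nn_integral_mono_AE)
    show "AE \<omega> in M. Z \<omega> \<le> liminf (\<lambda>k. liminf (\<lambda>m. a * Y k m \<omega>))"
      using lim by eventually_elim (auto intro!: Liminf_bounded elim!: eventually_mono)
  qed
  also have "\<dots> \<le> liminf (\<lambda>k. \<integral>\<^sup>+\<omega>. liminf (\<lambda>m. a * Y k m \<omega>) \<partial>M)"
    by (rule nn_integral_liminf) measurable
  also have "\<dots> \<le> limsup (\<lambda>k. \<integral>\<^sup>+\<omega>. liminf (\<lambda>m. a * Y k m \<omega>) \<partial>M)"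
    by (rule Liminf_le_Limsup) simp
  also have "\<dots> \<le> a * b"
  proof (rule Limsup_bounded)
    show "\<forall>\<^sub>F k in sequentially. (\<integral>\<^sup>+\<omega>. liminf (\<lambda>m. a * Y k m \<omega>) \<partial>M) \<le> a * b"
      using bd
    proof eventually_elim
      case (elim k)
      have "(\<integral>\<^sup>+\<omega>. liminf (\<lambda>m. a * Y k m \<omega>) \<partial>M) \<le> liminf (\<lambda>m. \<integral>\<^sup>+\<omega>. a * Y k m \<omega> \<partial>M)"
        by (rule nn_integral_liminf) measurable
      also have "\<dots> \<le> limsup (\<lambda>m. \<integral>\<^sup>+\<omega>. a * Y k m \<omega> \<partial>M)"
        by (rule Liminf_le_Limsup) simp
      also have "\<dots> \<le> a * b"
        using elim by (intro Limsup_bounded) (auto elim!: eventually_mono simp: nn_integral_cmult mult_left_mono)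
      finally show ?case .
    qed
  qed
  finally show ?thesis .
qed

section \<open>Pathwise comparison of Riemann sums with local time\<close>

context
  fixes w :: "real \<Rightarrow> real" and t :: real and l :: "real \<Rightarrow> real" and h :: "nat \<Rightarrow> real"
    and K :: "nat \<Rightarrow> nat" and q :: real and \<eta> :: "nat \<Rightarrow> real"
  assumes w: "continuous_on {0..} w" and t: "0 \<le> t"
    and occ: "occupation_density w t l" and l: "continuous_on UNIV l"
    and h: "\<And>m. 0 < h m" "h \<longlonglongrightarrow> 0"
    and K: "\<And>m. real (K m) * h m \<le> t" "(\<lambda>m. real (K m) * h m) \<longlonglongrightarrow> t"
    and \<eta>: "\<And>k. 0 < \<eta> k" "\<eta> \<longlonglongrightarrow> 0" and q: "1 < q"
begin

abbreviation (input) "path_rlt \<equiv> \<lambda>m. riemann_local_time (\<lambda>j. w (real j * h m)) (h m)"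

text \<open>Both Riemann sums are compared with the density \<open>l\<close> through their smoothed
  occupations. The smoothing error \<open>?y k\<close> is made small first; the discretisation error
  \<open>?r k m\<close> then vanishes in \<open>m\<close> for that \<open>k\<close>, so the
  threshold in \<open>m\<close> depends on \<open>k\<close>.\<close>

lemma eventually_exp_riemann_diff_le:
  assumes \<epsilon>: "\<And>k. 0 < \<epsilon> k" "\<epsilon> \<longlonglongrightarrow> 0" and c: "1 < c"
  shows "\<forall>\<^sub>F k in sequentially. \<forall>\<^sub>F m in sequentially.
    ennreal_exp (ennreal a * Lq_norm q (riemann_diff (\<lambda>j. w (real j * h m)) (h m) (\<eta> k) (\<epsilon> k) (K m))) \<le> ennreal c"
proof -
  have lm: "l \<in> borel_measurable borel" by (rule borel_measurable_continuous_onI[OF l])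
  note meas = borel_measurable_riemann_local_time borel_measurable_smoothed_occupation[OF w] lm
  let ?y = "\<lambda>k. Lq_norm q (\<lambda>x. smoothed_occupation w (\<eta> k) t x - l x)
    + Lq_norm q (\<lambda>x. smoothed_occupation w (\<epsilon> k) t x - l x)"
  let ?r = "\<lambda>k m. Lq_norm q (\<lambda>x. path_rlt m (\<eta> k) (K m) x - smoothed_occupation w (\<eta> k) t x)
    + Lq_norm q (\<lambda>x. path_rlt m (\<epsilon> k) (K m) x - smoothed_occupation w (\<epsilon> k) t x)"
  have le: "Lq_norm q (riemann_diff (\<lambda>j. w (real j * h m)) (h m) (\<eta> k) (\<epsilon> k) (K m)) \<le> ?r k m + ?y k" for k m
  proof -
    let ?R = "\<lambda>\<epsilon>. path_rlt m \<epsilon> (K m)" and ?s = "\<lambda>\<epsilon>. smoothed_occupation w \<epsilon> t"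
    have half: "Lq_norm q (\<lambda>x. ?R \<epsilon> x - l x)
        \<le> Lq_norm q (\<lambda>x. ?R \<epsilon> x - ?s \<epsilon> x) + Lq_norm q (\<lambda>x. ?s \<epsilon> x - l x)" for \<epsilon>
      using q by (intro Lq_norm_diff_triangle meas) auto
    have "Lq_norm q (\<lambda>x. ?R (\<eta> k) x - ?R (\<epsilon> k) x)
        \<le> Lq_norm q (\<lambda>x. ?R (\<eta> k) x - l x) + Lq_norm q (\<lambda>x. l x - ?R (\<epsilon> k) x)"
      using q by (intro Lq_norm_diff_triangle meas) auto
    also have "\<dots> = Lq_norm q (\<lambda>x. ?R (\<eta> k) x - l x) + Lq_norm q (\<lambda>x. ?R (\<epsilon> k) x - l x)"
      by (simp only: Lq_norm_minus_commute[of q l])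
    also have "\<dots> \<le> (Lq_norm q (\<lambda>x. ?R (\<eta> k) x - ?s (\<eta> k) x) + Lq_norm q (\<lambda>x. ?s (\<eta> k) x - l x))
        + (Lq_norm q (\<lambda>x. ?R (\<epsilon> k) x - ?s (\<epsilon> k) x) + Lq_norm q (\<lambda>x. ?s (\<epsilon> k) x - l x))"
      by (intro add_mono half)
    finally show ?thesis by (simp add: riemann_diff_def[abs_def] add_ac)
  qed
  have r0: "(\<lambda>m. ?r k m) \<longlonglongrightarrow> 0 + 0" for k
    by (intro tendsto_add riemann_local_time_Lq_tendsto w h K \<eta> \<epsilon> q)
  have "?y \<longlonglongrightarrow> 0 + 0"
    by (intro tendsto_add smoothed_occupation_Lq_tendsto[OF w occ l t] \<eta> \<epsilon> q)
  then have "(\<lambda>k. ennreal a * ?y k) \<longlonglongrightarrow> ennreal a * (0 + 0)"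
    by (intro ennreal_tendsto_cmult) auto
  then have "\<forall>\<^sub>F k in sequentially. ennreal a * ?y k < ennreal (ln c)"
    using c by (intro order_tendstoD) auto
  then show ?thesis
  proof eventually_elim
    case (elim k)
    have "(\<lambda>m. ennreal a * (?r k m + ?y k)) \<longlonglongrightarrow> ennreal a * (0 + 0 + ?y k)"
      by (intro ennreal_tendsto_cmult tendsto_add[OF r0 tendsto_const]) auto
    then have "\<forall>\<^sub>F m in sequentially. ennreal a * (?r k m + ?y k) < ennreal (ln c)"
      using elim by (intro order_tendstoD) auto
    then show ?case
    proof eventually_elim
      case (elim m)
      have "ennreal a * Lq_norm q (riemann_diff (\<lambda>j. w (real j * h m)) (h m) (\<eta> k) (\<epsilon> k) (K m)) \<le> ennreal (ln c)"
        using mult_left_mono[OF le[of m k], of "ennreal a"] elim by (meson less_imp_le order_trans zero_le)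
      from ennreal_exp_mono[OF this] show ?case
        using c by (simp add: ennreal_exp_ennreal)
    qed
  qed
qed

text \<open>Here \<open>\<epsilon>\<close> is fixed, so only replacing \<open>l\<close> by the
  smoothing at \<open>\<eta> k\<close>, and the discretisation, cost anything. Once the scaled error
  is below \<open>ln 2\<close>, its exponential is at most 2, a factor invisible in the growth
  rate.\<close>

lemma eventually_exp_local_time_diff_le:
  assumes \<epsilon>: "0 < \<epsilon>"
  shows "\<forall>\<^sub>F k in sequentially. \<forall>\<^sub>F m in sequentially.
    ennreal_exp (ennreal a * Lq_norm q (\<lambda>x. l x - smoothed_occupation w \<epsilon> t x))
    \<le> 2 * ennreal_exp (ennreal a * Lq_norm q (riemann_diff (\<lambda>j. w (real j * h m)) (h m) (\<eta> k) \<epsilon> (K m)))"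
proof -
  have lm: "l \<in> borel_measurable borel" by (rule borel_measurable_continuous_onI[OF l])
  note meas = borel_measurable_riemann_local_time borel_measurable_smoothed_occupation[OF w] lm
  let ?y = "\<lambda>k. Lq_norm q (\<lambda>x. smoothed_occupation w (\<eta> k) t x - l x)"
  let ?r = "\<lambda>k m. Lq_norm q (\<lambda>x. path_rlt m (\<eta> k) (K m) x - smoothed_occupation w (\<eta> k) t x)
    + Lq_norm q (\<lambda>x. path_rlt m \<epsilon> (K m) x - smoothed_occupation w \<epsilon> t x)"
  let ?D = "\<lambda>k m. Lq_norm q (riemann_diff (\<lambda>j. w (real j * h m)) (h m) (\<eta> k) \<epsilon> (K m))"
  have le: "Lq_norm q (\<lambda>x. l x - smoothed_occupation w \<epsilon> t x) \<le> (?r k m + ?y k) + ?D k m" for k m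
  proof -
    let ?R = "\<lambda>\<epsilon>. path_rlt m \<epsilon> (K m)" and ?s = "\<lambda>\<epsilon>. smoothed_occupation w \<epsilon> t"
    have "Lq_norm q (\<lambda>x. l x - ?s \<epsilon> x) \<le> Lq_norm q (\<lambda>x. l x - ?s (\<eta> k) x) + Lq_norm q (\<lambda>x. ?s (\<eta> k) x - ?s \<epsilon> x)"
      using q by (intro Lq_norm_diff_triangle meas) auto
    also have "Lq_norm q (\<lambda>x. ?s (\<eta> k) x - ?s \<epsilon> x)
        \<le> Lq_norm q (\<lambda>x. ?s (\<eta> k) x - ?R (\<eta> k) x) + Lq_norm q (\<lambda>x. ?R (\<eta> k) x - ?s \<epsilon> x)"
      using q by (intro Lq_norm_diff_triangle meas) auto
    also have "Lq_norm q (\<lambda>x. ?R (\<eta> k) x - ?s \<epsilon> x)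
        \<le> Lq_norm q (\<lambda>x. ?R (\<eta> k) x - ?R \<epsilon> x) + Lq_norm q (\<lambda>x. ?R \<epsilon> x - ?s \<epsilon> x)"
      using q by (intro Lq_norm_diff_triangle meas) auto
    finally have "Lq_norm q (\<lambda>x. l x - ?s \<epsilon> x) \<le> Lq_norm q (\<lambda>x. l x - ?s (\<eta> k) x)
        + (Lq_norm q (\<lambda>x. ?s (\<eta> k) x - ?R (\<eta> k) x)
        + (Lq_norm q (\<lambda>x. ?R (\<eta> k) x - ?R \<epsilon> x) + Lq_norm q (\<lambda>x. ?R \<epsilon> x - ?s \<epsilon> x)))"
      by (meson add_left_mono order_trans order_refl)
    then show ?thesis
      by (simp add: riemann_diff_def[abs_def] Lq_norm_minus_commute[of q l]
          Lq_norm_minus_commute[of q "?s (\<eta> k)" "?R (\<eta> k)"] add_ac)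
  qed
  have r0: "(\<lambda>m. ?r k m) \<longlonglongrightarrow> 0 + 0" for k
    by (intro tendsto_add riemann_local_time_Lq_tendsto w h K \<eta> \<epsilon> q)
  have "?y \<longlonglongrightarrow> 0"
    by (intro smoothed_occupation_Lq_tendsto[OF w occ l t] \<eta> q)
  then have "(\<lambda>k. ennreal a * ?y k) \<longlonglongrightarrow> ennreal a * 0"
    by (intro ennreal_tendsto_cmult) auto
  then have "\<forall>\<^sub>F k in sequentially. ennreal a * ?y k < ennreal (ln 2)"
    by (intro order_tendstoD) auto
  then show ?thesis
  proof eventually_elim
    case (elim k)
    have "(\<lambda>m. ennreal a * (?r k m + ?y k)) \<longlonglongrightarrow> ennreal a * (0 + 0 + ?y k)"
      by (intro ennreal_tendsto_cmult tendsto_add[OF r0 tendsto_const]) auto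
    then have "\<forall>\<^sub>F m in sequentially. ennreal a * (?r k m + ?y k) < ennreal (ln 2)"
      using elim by (intro order_tendstoD) auto
    then show ?case
    proof eventually_elim
      case (elim m)
      have "ennreal_exp (ennreal a * (?r k m + ?y k)) \<le> ennreal_exp (ennreal (ln 2))"
        using elim by (intro ennreal_exp_mono) simp
      then have two: "ennreal_exp (ennreal a * (?r k m + ?y k)) \<le> 2"
        by (simp add: ennreal_exp_ennreal)
      have "ennreal_exp (ennreal a * Lq_norm q (\<lambda>x. l x - smoothed_occupation w \<epsilon> t x))
          \<le> ennreal_exp (ennreal a * ((?r k m + ?y k) + ?D k m))"
        by (intro ennreal_exp_mono mult_left_mono le) simp
      also have "\<dots> = ennreal_exp (ennreal a * (?r k m + ?y k)) * ennreal_exp (ennreal a * ?D k m)"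
        by (simp only: distrib_left[of _ _ "?D k m"] ennreal_exp_add)
      also have "\<dots> \<le> 2 * ennreal_exp (ennreal a * ?D k m)"
        by (intro mult_right_mono two) simp
      finally show ?case .
    qed
  qed
qed

end


section \<open>Exponential moments over blocks of length \<open>\<delta>\<close>\<close>

locale local_time_blocks = standard_brownian_motion M W
  for M :: "'a measure" and W :: "real \<Rightarrow> 'a \<Rightarrow> real" +
  fixes L :: "real \<Rightarrow> real \<Rightarrow> 'a \<Rightarrow> real" and q lam \<delta> :: real
  assumes L: "local_time M W L" and q: "1 < q" and lam: "0 < lam"
    \<comment> \<open>the last bound makes \<open>walk_exp_moment_le_two\<close> applicable on a block of length \<open>\<delta>\<close>, with \<open>\<theta> = 8 lam\<close>\<close>
    and \<delta>: "0 < \<delta>" "\<delta> \<le> 1" "48 * lam * sqrt \<delta> \<le> 1"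
begin

text \<open>Exactly \<open>Suc m\<close> steps fill a block, so that every complete block has the
  same moment on the walk space.\<close>

definition mesh :: "nat \<Rightarrow> real" where
  "mesh m = \<delta> / real (Suc m)"

text \<open>The bound of \<open>walk_diff_moment_two_le\<close> at \<open>c = lam\<close>.\<close>

definition C\<^sub>0 :: real where
  "C\<^sub>0 = 2 * (exp (4 * lam * max 2 ((q - 1) / (4 * lam))) + 4)"

lemma C\<^sub>0_ge_1: "1 \<le> C\<^sub>0"
proof -
  have "1 \<le> 2 * (x + 4)" if "0 < x" for x :: real using that by simp
  from this[OF exp_gt_zero] show ?thesis unfolding C\<^sub>0_def .
qed

lemma mesh_pos: "0 < mesh m"
  using \<delta> by (simp add: mesh_def)

lemma mesh_tendsto_0: "mesh \<longlonglongrightarrow> 0"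
  unfolding mesh_def by (rule LIMSEQ_Suc[OF lim_const_over_n])

lemma Suc_mult_mesh: "real (Suc m) * mesh m = \<delta>"
  by (simp add: mesh_def)

text \<open>Once \<open>mesh m / sqrt \<epsilon>\<close> is below \<open>sqrt \<delta>\<close>, and
  likewise for \<open>\<eta>\<close>, each drift is at most \<open>3 * sqrt \<delta>\<close>; the
  requirement that \<open>8 * lam\<close> times this be at most \<open>1 / 2\<close> is the origin
  of the constant 48. Partial blocks are included because the last one may be incomplete.\<close>

lemma eventually_block_moment_le:
  assumes "0 < \<eta>" "0 < \<epsilon>"
  shows "\<forall>\<^sub>F m in sequentially. \<forall>k\<le>Suc m. walk_diff_moment q (2 * lam) (mesh m) \<eta> \<epsilon> k \<le> ennreal C\<^sub>0"
proof -
  have small: "\<forall>\<^sub>F m in sequentially. mesh m / sqrt \<epsilon> < sqrt \<delta>" if "0 < \<epsilon>" for \<epsilon>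
  proof (rule order_tendstoD)
    show "(\<lambda>m. mesh m / sqrt \<epsilon>) \<longlonglongrightarrow> 0 / sqrt \<epsilon>"
      using that by (intro tendsto_divide mesh_tendsto_0 tendsto_const) auto
  qed (use \<delta> in simp)
  from small[OF assms(1)] small[OF assms(2)] show ?thesis
  proof eventually_elim
    case (elim m)
    show ?case
    proof (intro allI impI)
      fix k assume k: "k \<le> Suc m"
      have km: "real k * mesh m \<le> \<delta>"
        using k mesh_pos[of m] by (subst Suc_mult_mesh[of m, symmetric]) (intro mult_right_mono, auto)
      have "8 * lam * (mesh m / sqrt \<epsilon> + 2 * sqrt (real k * mesh m)) \<le> 1 / 2"
        if "mesh m / sqrt \<epsilon> < sqrt \<delta>" for \<epsilon>
      proof -
        have "mesh m / sqrt \<epsilon> + 2 * sqrt (real k * mesh m) \<le> 3 * sqrt \<delta>"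
          using that real_sqrt_le_mono[OF km] by linarith
        then have "8 * lam * (mesh m / sqrt \<epsilon> + 2 * sqrt (real k * mesh m)) \<le> 8 * lam * (3 * sqrt \<delta>)"
          using lam by (intro mult_left_mono) auto
        then show ?thesis using \<delta>(3) by linarith
      qed
      with elim km \<delta> show "walk_diff_moment q (2 * lam) (mesh m) \<eta> \<epsilon> k \<le> ennreal C\<^sub>0"
        unfolding C\<^sub>0_def
        by (intro walk_diff_moment_two_le assms mesh_pos lam q) (auto simp: mult.commute)
    qed
  qed
qed

abbreviation sampled_diff :: "nat \<Rightarrow> real \<Rightarrow> real \<Rightarrow> nat \<Rightarrow> 'a \<Rightarrow> real \<Rightarrow> real" where
  "sampled_diff m \<eta> \<epsilon> K \<omega> \<equiv> riemann_diff (\<lambda>j. W (real j * mesh m) \<omega>) (mesh m) \<eta> \<epsilon> K"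

lemma measurable_sampled_diff [measurable]:
  "(\<lambda>\<omega>. Lq_norm q (sampled_diff m \<eta> \<epsilon> K \<omega>)) \<in> borel_measurable M"
proof -
  have "0 \<le> real j * mesh m" for j using mesh_pos[of m] by simp
  then have [measurable]: "W (real j * mesh m) \<in> borel_measurable M" for j
    by (rule random_variable)
  show ?thesis by measurable
qed

text \<open>The bound must hold uniformly for all small pairs, since later \<open>\<eta>\<close>
  tends to 0 while \<open>\<epsilon>\<close> stays fixed. If it failed, there would be sequences of
  pairs tending to 0 that violate it, contrary to \<open>double_limsup_moment_le\<close>. Only the
  threshold for \<open>m\<close> may depend on the pair.\<close>

lemma block_moment_near_1:
  assumes \<rho>: "0 < \<rho>"
  obtains \<epsilon>\<^sub>0 where "0 < \<epsilon>\<^sub>0"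
    "\<And>\<eta> \<epsilon>. \<lbrakk>0 < \<eta>; \<eta> < \<epsilon>\<^sub>0; 0 < \<epsilon>; \<epsilon> < \<epsilon>\<^sub>0\<rbrakk> \<Longrightarrow>
      \<forall>\<^sub>F m in sequentially. walk_diff_moment q lam (mesh m) \<eta> \<epsilon> (Suc m) \<le> ennreal (1 + \<rho>)"
proof -
  define P where "P \<eta> \<epsilon> \<longleftrightarrow> (\<forall>\<^sub>F m in sequentially. walk_diff_moment q lam (mesh m) \<eta> \<epsilon> (Suc m) \<le> ennreal (1 + \<rho>))"
    for \<eta> \<epsilon>
  have "\<exists>\<epsilon>\<^sub>0>0. \<forall>\<eta> \<epsilon>. 0 < \<eta> \<and> \<eta> < \<epsilon>\<^sub>0 \<and> 0 < \<epsilon> \<and> \<epsilon> < \<epsilon>\<^sub>0 \<longrightarrow> P \<eta> \<epsilon>"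
  proof (rule ccontr)
    assume "\<not> ?thesis"
    then have "\<exists>\<eta> \<epsilon>. 0 < \<eta> \<and> \<eta> < 1 / real (Suc k) \<and> 0 < \<epsilon> \<and> \<epsilon> < 1 / real (Suc k) \<and> \<not> P \<eta> \<epsilon>" for k
      by (metis of_nat_0_less_iff zero_less_Suc zero_less_divide_1_iff)
    then obtain \<eta> \<epsilon> where \<eta>: "\<And>k. 0 < \<eta> k" "\<And>k. \<eta> k < 1 / real (Suc k)"
      and \<epsilon>: "\<And>k. 0 < \<epsilon> k" "\<And>k. \<epsilon> k < 1 / real (Suc k)" and nP: "\<And>k. \<not> P (\<eta> k) (\<epsilon> k)"
      by metis
    have inv0: "(\<lambda>k. 1 / real (Suc k)) \<longlonglongrightarrow> 0" by (rule LIMSEQ_Suc[OF lim_const_over_n])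
    have \<eta>0: "\<eta> \<longlonglongrightarrow> 0"
      by (rule tendsto_sandwich[OF _ _ tendsto_const inv0]) (auto intro!: always_eventually less_imp_le \<eta> simp del: of_nat_Suc)
    have \<epsilon>0: "\<epsilon> \<longlonglongrightarrow> 0"
      by (rule tendsto_sandwich[OF _ _ tendsto_const inv0]) (auto intro!: always_eventually less_imp_le \<epsilon> simp del: of_nat_Suc)
    define Y where "Y k m \<omega> = ennreal_exp (ennreal lam * Lq_norm q (sampled_diff m (\<eta> k) (\<epsilon> k) (Suc m) \<omega>))" for k m \<omega>
    have Y1: "(\<integral>\<^sup>+\<omega>. Y k m \<omega> \<partial>M) = walk_diff_moment q lam (mesh m) (\<eta> k) (\<epsilon> k) (Suc m)" for k m
      unfolding Y_def by (rule walk_diff_moment_eq[OF mesh_pos])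
    \<comment> \<open>Squaring the exponential doubles \<open>lam\<close>, so the second moment is
      the one bounded by \<open>C\<^sub>0\<close>.\<close>
    have Y2: "(\<integral>\<^sup>+\<omega>. Y k m \<omega> * Y k m \<omega> \<partial>M) = walk_diff_moment q (2 * lam) (mesh m) (\<eta> k) (\<epsilon> k) (Suc m)" for k m
    proof -
      have "ennreal (2 * lam) = ennreal lam + ennreal lam" using lam by (simp flip: ennreal_plus)
      then have "Y k m \<omega> * Y k m \<omega> = ennreal_exp (ennreal (2 * lam) * Lq_norm q (sampled_diff m (\<eta> k) (\<epsilon> k) (Suc m) \<omega>))" for \<omega>
        by (simp add: Y_def ennreal_exp_add[symmetric] distrib_right)
      then show ?thesis by (simp only: walk_diff_moment_eq[OF mesh_pos])
    qed
    have "\<forall>\<^sub>F k in sequentially. \<forall>\<^sub>F m in sequentially. (\<integral>\<^sup>+\<omega>. Y k m \<omega> \<partial>M) \<le> ennreal (1 + \<rho>)"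
    proof (rule double_limsup_moment_le[where C = C\<^sub>0])
      show "Y k m \<in> borel_measurable M" for k m unfolding Y_def by measurable
      show "\<forall>\<^sub>F m in sequentially. (\<integral>\<^sup>+\<omega>. Y k m \<omega> * Y k m \<omega> \<partial>M) \<le> ennreal C\<^sub>0" for k
        unfolding Y2 using eventually_block_moment_le[OF \<eta>(1)[of k] \<epsilon>(1)[of k]]
        by eventually_elim simp
      have "AE \<omega> in M. continuous_on UNIV (\<lambda>x. L \<delta> x \<omega>) \<and> occupation_density (\<lambda>s. W s \<omega>) \<delta> (\<lambda>x. L \<delta> x \<omega>)"
        using L \<delta> by (simp add: local_time_def)
      with continuous_paths
      show "AE \<omega> in M. \<forall>c>1. \<forall>\<^sub>F k in sequentially. \<forall>\<^sub>F m in sequentially. Y k m \<omega> \<le> ennreal c"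
      proof eventually_elim
        case (elim \<omega>)
        show ?case
          unfolding Y_def
        proof (intro allI impI)
          fix c :: real assume "1 < c"
          then show "\<forall>\<^sub>F k in sequentially. \<forall>\<^sub>F m in sequentially.
            ennreal_exp (ennreal lam * Lq_norm q (sampled_diff m (\<eta> k) (\<epsilon> k) (Suc m) \<omega>)) \<le> ennreal c"
            using elim \<delta> q
            by (intro eventually_exp_riemann_diff_le[where t = \<delta> and l = "\<lambda>x. L \<delta> x \<omega>"])
              (auto simp: Suc_mult_mesh mesh_pos mesh_tendsto_0 \<eta> \<epsilon> \<eta>0 \<epsilon>0 simp del: of_nat_Suc)
        qed
      qed
    qed (use C\<^sub>0_ge_1 \<rho> in auto)
    then have "\<forall>\<^sub>F k in sequentially. P (\<eta> k) (\<epsilon> k)" unfolding P_def Y1 .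
    then show False using nP by simp
  qed
  then show thesis using that unfolding P_def by metis
qed

text \<open>Each complete block contributes a factor of at most \<open>1 + \<rho>\<close>, the
  incomplete rest at most \<open>C\<^sub>0\<close>, and the passage from Riemann sums to local time
  the factor 2. The threshold \<open>\<epsilon>\<^sub>0\<close> does not depend on \<open>t\<close>,
  which lets \<open>t\<close> tend to infinity first.\<close>

lemma local_time_diff_moment_le:
  assumes \<rho>: "0 < \<rho>"
  obtains \<epsilon>\<^sub>0 where "0 < \<epsilon>\<^sub>0"
    "\<And>\<epsilon> t. \<lbrakk>0 < \<epsilon>; \<epsilon> < \<epsilon>\<^sub>0; 0 \<le> t\<rbrakk> \<Longrightarrow>
      (\<integral>\<^sup>+\<omega>. ennreal_exp (ennreal lam * Lq_norm q (\<lambda>x. L t x \<omega> - smoothed_local_time W \<epsilon> t x \<omega>)) \<partial>M)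
        \<le> ennreal (2 * C\<^sub>0 * (1 + \<rho>) ^ nat \<lfloor>t / \<delta>\<rfloor>)"
proof -
  obtain \<epsilon>\<^sub>0 where \<epsilon>\<^sub>0: "0 < \<epsilon>\<^sub>0" and near: "\<And>\<eta> \<epsilon>. \<lbrakk>0 < \<eta>; \<eta> < \<epsilon>\<^sub>0; 0 < \<epsilon>; \<epsilon> < \<epsilon>\<^sub>0\<rbrakk> \<Longrightarrow>
      \<forall>\<^sub>F m in sequentially. walk_diff_moment q lam (mesh m) \<eta> \<epsilon> (Suc m) \<le> ennreal (1 + \<rho>)"
    using block_moment_near_1[OF \<rho>] by blast
  show thesis
  proof (rule that[OF \<epsilon>\<^sub>0])
    fix \<epsilon> t :: real assume \<epsilon>: "0 < \<epsilon>" "\<epsilon> < \<epsilon>\<^sub>0" and t: "0 \<le> t"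
    \<comment> \<open>Starting at half of \<open>\<epsilon>\<^sub>0\<close> keeps every
      \<open>\<eta> k\<close> strictly within the range of the block bound.\<close>
    define \<eta> where "\<eta> k = \<epsilon>\<^sub>0 / 2 / real (Suc k)" for k
    have \<eta>: "0 < \<eta> k" "\<eta> k < \<epsilon>\<^sub>0" for k
      using \<epsilon>\<^sub>0 by (auto simp: \<eta>_def field_simps intro: add_pos_nonneg)
    have \<eta>0: "\<eta> \<longlonglongrightarrow> 0" unfolding \<eta>_def by (rule LIMSEQ_Suc[OF lim_const_over_n])
    define K where "K m = nat \<lfloor>t / mesh m\<rfloor>" for m
    have K_le: "real (K m) * mesh m \<le> t" and K_ge: "t - mesh m \<le> real (K m) * mesh m" for m
    proof -
      have "0 \<le> t / mesh m" using t mesh_pos[of m] by simp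
      then have "real (K m) \<le> t / mesh m" "t / mesh m - 1 \<le> real (K m)"
        unfolding K_def by linarith+
      then show "real (K m) * mesh m \<le> t" "t - mesh m \<le> real (K m) * mesh m"
        using mesh_pos[of m] by (auto simp: field_simps)
    qed
    have K_lim: "(\<lambda>m. real (K m) * mesh m) \<longlonglongrightarrow> t"
    proof (rule tendsto_sandwich[OF _ _ _ tendsto_const])
      show "(\<lambda>m. t - mesh m) \<longlonglongrightarrow> t" using tendsto_diff[OF tendsto_const mesh_tendsto_0, of t] by simp
    qed (auto intro!: always_eventually K_le K_ge)
    define N where "N = nat \<lfloor>t / \<delta>\<rfloor>"
    \<comment> \<open>The number of complete blocks is bounded independently of the mesh, so one
      bound serves all fine grids.\<close>
    have div_le: "K m div Suc m \<le> N" for m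
    proof -
      have "real (K m div Suc m) * real (Suc m) \<le> real (K m)"
        by (metis div_times_less_eq_dividend of_nat_le_iff of_nat_mult)
      then have "real (K m div Suc m) * real (Suc m) * mesh m \<le> real (K m) * mesh m"
        using mesh_pos[of m] by (intro mult_right_mono) auto
      also have "\<dots> \<le> t" by (rule K_le)
      finally have "real (K m div Suc m) * \<delta> \<le> t" by (simp only: mult.assoc Suc_mult_mesh)
      then have "real (K m div Suc m) \<le> t / \<delta>" using \<delta> by (simp add: field_simps)
      then show ?thesis unfolding N_def by linarith
    qed
    define Y where "Y k m \<omega> = ennreal_exp (ennreal lam * Lq_norm q (sampled_diff m (\<eta> k) \<epsilon> (K m) \<omega>))" for k m \<omega>
    have "(\<integral>\<^sup>+\<omega>. ennreal_exp (ennreal lam * Lq_norm q (\<lambda>x. L t x \<omega> - smoothed_occupation (\<lambda>s. W s \<omega>) \<epsilon> t x)) \<partial>M)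
        \<le> 2 * ennreal (C\<^sub>0 * (1 + \<rho>) ^ N)"
    proof (rule double_fatou_le[where Y = Y])
      show "Y k m \<in> borel_measurable M" for k m unfolding Y_def by measurable
      have "AE \<omega> in M. continuous_on UNIV (\<lambda>x. L t x \<omega>) \<and> occupation_density (\<lambda>s. W s \<omega>) t (\<lambda>x. L t x \<omega>)"
        using L t by (simp add: local_time_def)
      with continuous_paths
      show "AE \<omega> in M. \<forall>\<^sub>F k in sequentially. \<forall>\<^sub>F m in sequentially.
        ennreal_exp (ennreal lam * Lq_norm q (\<lambda>x. L t x \<omega> - smoothed_occupation (\<lambda>s. W s \<omega>) \<epsilon> t x)) \<le> 2 * Y k m \<omega>"
      proof eventually_elim
        case (elim \<omega>)
        show ?case
          unfolding Y_def using elim t q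
          by (intro eventually_exp_local_time_diff_le)
            (auto simp: mesh_pos mesh_tendsto_0 \<eta> \<epsilon> \<eta>0 K_le K_lim)
      qed
      show "\<forall>\<^sub>F k in sequentially. \<forall>\<^sub>F m in sequentially. (\<integral>\<^sup>+\<omega>. Y k m \<omega> \<partial>M) \<le> ennreal (C\<^sub>0 * (1 + \<rho>) ^ N)"
      proof (rule always_eventually, rule allI)
        fix k
        show "\<forall>\<^sub>F m in sequentially. (\<integral>\<^sup>+\<omega>. Y k m \<omega> \<partial>M) \<le> ennreal (C\<^sub>0 * (1 + \<rho>) ^ N)"
          using near[OF \<eta>[of k] \<epsilon>] eventually_block_moment_le[OF \<eta>(1)[of k] \<epsilon>(1)]
        proof eventually_elim
          case (elim m)
          let ?A = "walk_diff_moment q lam (mesh m) (\<eta> k) \<epsilon>"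
          \<comment> \<open>The rest has fewer than \<open>Suc m\<close> steps; its moment at
            \<open>lam\<close> is dominated by the one at \<open>2 * lam\<close>.\<close>
          have "?A (K m mod Suc m) \<le> walk_diff_moment q (2 * lam) (mesh m) (\<eta> k) \<epsilon> (K m mod Suc m)"
            using lam by (intro walk_diff_moment_mono) simp
          also have "\<dots> \<le> ennreal C\<^sub>0"
            using elim(2) by (simp add: mod_less_divisor less_imp_le)
          finally have rest: "?A (K m mod Suc m) \<le> ennreal C\<^sub>0" .
          have "(\<integral>\<^sup>+\<omega>. Y k m \<omega> \<partial>M) = ?A (K m div Suc m * Suc m + K m mod Suc m)"
            unfolding Y_def by (subst walk_diff_moment_eq[OF mesh_pos]) (simp only: div_mult_mod_eq)
          also have "\<dots> \<le> ?A (Suc m) ^ (K m div Suc m) * ?A (K m mod Suc m)"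
            by (rule walk_diff_moment_le_power[OF mesh_pos q])
          also have "\<dots> \<le> ennreal (1 + \<rho>) ^ (K m div Suc m) * ennreal C\<^sub>0"
            using elim(1) by (intro mult_mono power_mono rest) auto
          also have "\<dots> = ennreal ((1 + \<rho>) ^ (K m div Suc m) * C\<^sub>0)"
            using \<rho> C\<^sub>0_ge_1 by (simp add: ennreal_power ennreal_mult del: ennreal_plus)
          also have "\<dots> \<le> ennreal (C\<^sub>0 * (1 + \<rho>) ^ N)"
            using \<rho> C\<^sub>0_ge_1 div_le[of m]
            by (intro ennreal_leI) (simp add: mult.commute power_increasing)
          finally show ?case .
        qed
      qed
    qed
    also have "2 * ennreal (C\<^sub>0 * (1 + \<rho>) ^ N) = ennreal (2 * C\<^sub>0 * (1 + \<rho>) ^ nat \<lfloor>t / \<delta>\<rfloor>)"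
      using \<rho> C\<^sub>0_ge_1 by (simp add: N_def ennreal_mult mult.assoc)
    finally show "(\<integral>\<^sup>+\<omega>. ennreal_exp (ennreal lam * Lq_norm q (\<lambda>x. L t x \<omega> - smoothed_local_time W \<epsilon> t x \<omega>)) \<partial>M)
        \<le> ennreal (2 * C\<^sub>0 * (1 + \<rho>) ^ nat \<lfloor>t / \<delta>\<rfloor>)"
      by (simp only: smoothed_occupation_def smoothed_local_time_def)
  qed
qed

end

section \<open>From moments to the logarithmic growth rate\<close>

lemma ennreal_ln_nonneg: "1 \<le> x \<Longrightarrow> 0 \<le> ennreal_ln x"
  by (cases x) (auto simp: ennreal_ln_def)

lemma ennreal_ln_le:
  assumes "1 \<le> x" "x \<le> ennreal r"
  shows "ennreal_ln x \<le> ereal (ln r)"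
proof -
  obtain y where y: "x = ennreal y" "1 \<le> y" using assms by (cases x) (auto simp: top_unique)
  then have "y \<le> r" using assms by (metis ennreal_le_iff2 dual_order.trans le_numeral_extra(1) not_one_le_zero order_trans)
  then show ?thesis using y by (auto simp: ennreal_ln_def)
qed

theorem proposition1p10:
  fixes M :: "'a measure" and W :: "real \<Rightarrow> 'a \<Rightarrow> real"
    and L :: "real \<Rightarrow> real \<Rightarrow> 'a \<Rightarrow> real"
    and q lam :: real
  assumes "q > 1"
    and "standard_brownian_motion M W"
    and "local_time M W L"
    and "lam > 0"
  shows "Limsup (at_right 0) (\<lambda>\<epsilon>::real. Limsup at_top (\<lambda>t::real.
           ereal (1 / t) * ennreal_ln (\<integral>\<^sup>+\<omega>.
             ennreal_exp (ennreal lam *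
               Lq_norm q (\<lambda>x. L t x \<omega> - smoothed_local_time W \<epsilon> t x \<omega>)) \<partial>M))) = 0"
proof -
  \<comment> \<open>The largest block length that the locale allows; it is fixed before
    \<open>\<rho>\<close> and \<open>\<epsilon>\<close> are chosen.\<close>
  define \<delta> where "\<delta> = min 1 ((1 / (48 * lam))\<^sup>2)"
  have \<delta>: "0 < \<delta>" "\<delta> \<le> 1" "48 * lam * sqrt \<delta> \<le> 1"
  proof -
    have "sqrt \<delta> \<le> sqrt ((1 / (48 * lam))\<^sup>2)" unfolding \<delta>_def by (intro real_sqrt_le_mono) simp
    then have "sqrt \<delta> \<le> 1 / (48 * lam)" using assms(4) by simp
    then show "48 * lam * sqrt \<delta> \<le> 1" using assms(4) by (simp add: field_simps)
  qed (use assms(4) in \<open>auto simp: \<delta>_def\<close>)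
  interpret standard_brownian_motion M W by fact
  interpret local_time_blocks M W L q lam \<delta>
    using assms \<delta> by unfold_locales
  define E where "E \<epsilon> t = (\<integral>\<^sup>+\<omega>. ennreal_exp (ennreal lam *
               Lq_norm q (\<lambda>x. L t x \<omega> - smoothed_local_time W \<epsilon> t x \<omega>)) \<partial>M)" for \<epsilon> t
  define F where "F \<epsilon> = Limsup at_top (\<lambda>t. ereal (1 / t) * ennreal_ln (E \<epsilon> t))" for \<epsilon>
  have E1: "1 \<le> E \<epsilon> t" for \<epsilon> t
  proof -
    have "(\<integral>\<^sup>+\<omega>. 1 \<partial>M) \<le> E \<epsilon> t" unfolding E_def by (intro nn_integral_mono ennreal_exp_ge_1)
    then show ?thesis by (simp add: emeasure_space_1)
  qed
  \<comment> \<open>The exponent is nonnegative, so the moment is at least 1 and its logarithm at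
    least 0: the lower half of the claim.\<close>
  have F_nonneg: "0 \<le> F \<epsilon>" for \<epsilon>
  proof -
    have "0 \<le> Liminf at_top (\<lambda>t. ereal (1 / t) * ennreal_ln (E \<epsilon> t))"
    proof (rule Liminf_bounded)
      show "\<forall>\<^sub>F t in at_top. 0 \<le> ereal (1 / t) * ennreal_ln (E \<epsilon> t)"
        using eventually_gt_at_top[of 0] by eventually_elim (auto intro!: ereal_0_le_mult ennreal_ln_nonneg E1)
    qed
    also have "\<dots> \<le> F \<epsilon>" unfolding F_def by (rule Liminf_le_Limsup) simp
    finally show ?thesis .
  qed
  have F_le: "\<forall>\<^sub>F \<epsilon> in at_right 0. F \<epsilon> \<le> ereal (\<rho> / \<delta>)" if \<rho>: "0 < \<rho>" for \<rho>
  proof -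
    obtain \<epsilon>\<^sub>0 where \<epsilon>\<^sub>0: "0 < \<epsilon>\<^sub>0" and bound: "\<And>\<epsilon> t. \<lbrakk>0 < \<epsilon>; \<epsilon> < \<epsilon>\<^sub>0; 0 \<le> t\<rbrakk> \<Longrightarrow>
        E \<epsilon> t \<le> ennreal (2 * C\<^sub>0 * (1 + \<rho>) ^ nat \<lfloor>t / \<delta>\<rfloor>)"
      unfolding E_def using local_time_diff_moment_le[OF \<rho>] by blast
    have "F \<epsilon> \<le> ereal (\<rho> / \<delta>)" if \<epsilon>: "0 < \<epsilon>" "\<epsilon> < \<epsilon>\<^sub>0" for \<epsilon>
    proof -
      \<comment> \<open>The prefactor \<open>2 * C\<^sub>0\<close> costs
        \<open>ln (2 * C\<^sub>0) / t\<close>, which the limit in \<open>t\<close> removes; each of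
        the at most \<open>t / \<delta>\<close> blocks costs
        \<open>ln (1 + \<rho>) \<le> \<rho>\<close>.\<close>
      have le: "\<forall>\<^sub>F t in at_top. ereal (1 / t) * ennreal_ln (E \<epsilon> t) \<le> ereal (ln (2 * C\<^sub>0) / t + \<rho> / \<delta>)"
        using eventually_gt_at_top[of 0]
      proof eventually_elim
        case (elim t)
        define N where "N = nat \<lfloor>t / \<delta>\<rfloor>"
        have N: "real N \<le> t / \<delta>" using elim \<delta> by (simp add: N_def)
        have "ennreal_ln (E \<epsilon> t) \<le> ereal (ln (2 * C\<^sub>0 * (1 + \<rho>) ^ N))"
          unfolding N_def using elim \<epsilon> by (intro ennreal_ln_le E1 bound) auto
        also have "ln (2 * C\<^sub>0 * (1 + \<rho>) ^ N) = ln (2 * C\<^sub>0) + real N * ln (1 + \<rho>)"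
          using C\<^sub>0_ge_1 \<rho> by (simp add: ln_mult ln_realpow)
        also have "real N * ln (1 + \<rho>) \<le> t / \<delta> * \<rho>"
          using N \<rho> elim \<delta>(1) ln_add_one_self_le_self[of \<rho>] by (intro mult_mono) auto
        finally have "ereal (1 / t) * ennreal_ln (E \<epsilon> t) \<le> ereal (1 / t) * ereal (ln (2 * C\<^sub>0) + t / \<delta> * \<rho>)"
          using elim by (intro ereal_mult_left_mono) auto
        also have "\<dots> = ereal (ln (2 * C\<^sub>0) / t + \<rho> / \<delta>)"
          using elim by (simp add: field_simps)
        finally show ?case .
      qed
      have "((\<lambda>t. ln (2 * C\<^sub>0) / t) \<longlongrightarrow> 0) at_top"
        by (intro tendsto_divide_0[OF tendsto_const] filterlim_at_top_imp_at_infinity filterlim_ident)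
      from tendsto_add[OF this tendsto_const[of "\<rho> / \<delta>"]]
      have "((\<lambda>t. ereal (ln (2 * C\<^sub>0) / t + \<rho> / \<delta>)) \<longlongrightarrow> ereal (\<rho> / \<delta>)) at_top" by simp
      then have "Limsup at_top (\<lambda>t. ereal (ln (2 * C\<^sub>0) / t + \<rho> / \<delta>)) = ereal (\<rho> / \<delta>)"
        by (intro lim_imp_Limsup) auto
      with Limsup_mono[OF le] show ?thesis unfolding F_def by simp
    qed
    then show ?thesis
      using eventually_at_right_real[OF \<epsilon>\<^sub>0] by (auto elim!: eventually_mono)
  qed
  have "Limsup (at_right 0) F \<le> 0"
  proof (rule ereal_le_epsilon2)
    fix e :: real assume e: "0 < e"
    \<comment> \<open>As \<open>\<delta>\<close> is fixed, \<open>\<rho> = e * \<delta>\<close>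
      yields the rate \<open>e\<close>.\<close>
    then have "\<forall>\<^sub>F \<epsilon> in at_right 0. F \<epsilon> \<le> ereal e"
      using F_le[of "e * \<delta>"] \<delta> by simp
    then show "Limsup (at_right 0) F \<le> 0 + ereal e" by (simp add: Limsup_bounded)
  qed
  moreover have "0 \<le> Limsup (at_right 0) F"
  proof -
    have "0 \<le> Liminf (at_right 0) F"
      by (intro Liminf_bounded always_eventually allI F_nonneg)
    also have "\<dots> \<le> Limsup (at_right 0) F" by (rule Liminf_le_Limsup) simp
    finally show ?thesis .
  qed
  ultimately show ?thesis unfolding F_def E_def by (rule antisym)
qed

end
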